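(* Let $d\ge2$. From the family of Beckner-type inequalities $$\int f^2\,d\mu_{\mathbb S}\le A\left(\int f^{2/p}\,d\mu_{\mathbb S}\right)^p+\frac{16}{(m+2-d)(3d-2+m)}\int\Gamma_{\mathbb S}(f)\,d\mu_{\mathbb S}\qquad\text{for all } m\ge d+2\text{ and all smooth nonnegative } f\text{ on }\mathbb S^d,$$ where $p=1+\frac2{m-d}\in(1,2]$ and $A=\left(\frac{c(d,d)}{c(m,d)}\right)^{\frac2{m-d}}\frac{m+d-2}{m+3d-2}$, one can prove that there exists a constant $C>0$ depending only on $d$ such that, for any smooth function $f$ on the sphere $\mathbb S^d$, $$\left(\int|f|^{\frac{2d}{d-2}}\,d\mu_{\mathbb S}\right)^{\frac{d-2}{d}}\le\int f^2\,d\mu_{\mathbb S}+C\int\Gamma_{\mathbb S}(f)\,d\mu_{\mathbb S}.$$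
   Context: $\mathbb S^d\subset\mathbb R^{d+1}$ is the unit sphere with its standard Riemannian metric, $\mu_{\mathbb S}$ is the uniform (normalized Riemannian) probability measure on $\mathbb S^d$, and $\Gamma_{\mathbb S}(f)=|\nabla_{\mathbb S}f|^2$ is the carré du champ of the Laplace-Beltrami operator $\Delta_{\mathbb S}$ on $\mathbb S^d$. For $m>0$, $c(m,d)=\int_{\mathbb R^d}(1+|y|^2)^{-\frac{m+d}2}dy=\frac{\Gamma(m/2)}{\Gamma((m+d)/2)}\pi^{d/2}$, where in this last formula $\Gamma$ is Euler's Gamma function.
   Formalization: The case d = 2 is excluded, since there the exponent 2d/(d-2) is undefined and, read as the sup norm, the claimed inequality is false on the 2-sphere; the formal theorem covers all d ≥ 3. *)

theory Defs
  imports "HOL-Probability.Probability"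
begin

text \<open>The measure lives on the Borel sets of the sphere itself, so values of a function off the
  sphere play no role. It is the radial projection of the uniform distribution on the punctured unit
  ball: in polar coordinates, Lebesgue measure is \<open>r ^ d dr\<close> times the Riemannian measure, so
  the image measure is the Riemannian measure divided by its total mass. That it is an
  orthogonally invariant probability measure is shown below.\<close>

definition sphere_measure :: "'a::euclidean_space measure" where
  "sphere_measure =
     distr (uniform_measure (restrict_space lborel (- {0})) (ball 0 1 - {0}))
       (restrict_space borel (sphere 0 1)) (\<lambda>x. x /\<^sub>R norm x)"

text \<open>Partial derivatives are replaced by all directional derivatives, which for fixed \<open>x\<close> are
  linear combinations of them.\<close>

primrec C_k_on :: "nat \<Rightarrow> ('a::euclidean_space \<Rightarrow> real) \<Rightarrow> 'a set \<Rightarrow> bool" where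
  "C_k_on 0 f U \<longleftrightarrow> continuous_on U f"
| "C_k_on (Suc k) f U \<longleftrightarrow>
     (\<forall>x\<in>U. f differentiable (at x)) \<and>
     (\<forall>v. C_k_on k (\<lambda>x. frechet_derivative f (at x) v) U)"

text \<open>Smoothness on an embedded submanifold: near each point, the function is the restriction of a
  \<open>C\<^sup>\<infinity>\<close> function on an open subset of the ambient space.\<close>

definition smooth_on_sphere :: "('a::euclidean_space \<Rightarrow> real) \<Rightarrow> bool" where
  "smooth_on_sphere f \<longleftrightarrow>
     (\<forall>x\<in>sphere 0 1. \<exists>U g. open U \<and> x \<in> U \<and> (\<forall>k. C_k_on k g U) \<and>
        (\<forall>y\<in>U \<inter> sphere 0 1. f y = g y))"

text \<open>The tangent space at \<open>x\<close> is the orthogonal complement of \<open>x\<close>, with the induced inner product.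
  A derivative within the sphere is determined on that space only, hence the gradient is
  the unique tangent vector representing it.\<close>

definition sphere_grad :: "('a::euclidean_space \<Rightarrow> real) \<Rightarrow> 'a \<Rightarrow> 'a" where
  "sphere_grad f x =
     (THE v. v \<bullet> x = 0 \<and> (f has_derivative (\<lambda>w. v \<bullet> w)) (at x within sphere 0 1))"

definition carre_du_champ :: "('a::euclidean_space \<Rightarrow> real) \<Rightarrow> 'a \<Rightarrow> real" where
  "carre_du_champ f x = (norm (sphere_grad f x))\<^sup>2"

text \<open>Here \<open>\<real>\<^sup>d\<close>, for a natural number \<open>d\<close> that is not a type, is the product of \<open>d\<close> copies of the line.\<close>

definition c_const :: "real \<Rightarrow> nat \<Rightarrow> real" where
  "c_const m d =
     (\<integral>y. (1 + (\<Sum>i<d. (y i)\<^sup>2)) powr (- ((m + real d) / 2)) \<partial>(Pi\<^sub>M {..<d} (\<lambda>_. lborel)))"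

definition beckner_p :: "real \<Rightarrow> nat \<Rightarrow> real" where
  "beckner_p m d = 1 + 2 / (m - real d)"

definition beckner_A :: "real \<Rightarrow> nat \<Rightarrow> real" where
  "beckner_A m d = (c_const (real d) d / c_const m d) powr (2 / (m - real d)) *
     ((m + real d - 2) / (m + 3 * real d - 2))"


lemma space_sphere_measure [simp]:
  "space (sphere_measure :: 'a::euclidean_space measure) = sphere 0 1"
  by (simp add: sphere_measure_def space_restrict_space)

lemma sets_sphere_measure [measurable_cong]:
  "sets (sphere_measure :: 'a::euclidean_space measure) = sets (restrict_space borel (sphere 0 1))"
  by (simp add: sphere_measure_def)

lemma radial_projection_measurable:
  "(\<lambda>x::'a::euclidean_space. x /\<^sub>R norm x)
     \<in> measurable (uniform_measure (restrict_space lborel (- {0})) (ball 0 1 - {0}))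
         (restrict_space borel (sphere 0 1))"
proof -
  have "(\<lambda>x::'a. x /\<^sub>R norm x) \<in> restrict_space lborel (- {0}) \<rightarrow>\<^sub>M restrict_space borel (sphere 0 1)"
    by (rule measurable_restrict_space3) (auto simp: measurable_lborel1)
  moreover have "sets (uniform_measure (restrict_space lborel (- {0})) (ball 0 1 - {0::'a}))
      = sets (restrict_space lborel (- {0::'a}))"
    by simp
  ultimately show ?thesis
    using measurable_cong_sets by blast
qed

lemma emeasure_sphere_measure:
  fixes B :: "'a::euclidean_space set"
  assumes "B \<in> sets borel" "B \<subseteq> sphere 0 1"
  shows "emeasure sphere_measure B =
    emeasure lborel {x \<in> ball 0 1 - {0}. x /\<^sub>R norm x \<in> B} / emeasure lborel (ball (0::'a) 1)"
proof -
  let ?R = "restrict_space lborel (- {0::'a})"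
  have B: "B \<in> sets (restrict_space borel (sphere 0 1))"
    using assms by (auto simp: sets_restrict_space_iff)
  have pre: "(\<lambda>x. x /\<^sub>R norm x) -` B \<inter> (- {0}) \<in> sets ?R"
    using measurable_sets[OF radial_projection_measurable B]
    by (simp add: space_restrict_space)
  have ball: "ball 0 1 - {0::'a} \<in> sets ?R"
    by (auto simp: sets_restrict_space_iff)
  have "emeasure lborel (ball (0::'a) 1 - {0}) = emeasure lborel (ball (0::'a) 1)"
    by (rule emeasure_Diff_null_set) auto
  moreover have "(ball 0 1 - {0}) \<inter> ((\<lambda>x. x /\<^sub>R norm x) -` B \<inter> (- {0})) =
      {x \<in> ball 0 1 - {0::'a}. x /\<^sub>R norm x \<in> B}"
    by auto
  ultimately show ?thesis
    unfolding sphere_measure_def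
    by (subst emeasure_distr[OF radial_projection_measurable B])
      (use pre ball in \<open>simp add: space_restrict_space emeasure_uniform_measure emeasure_restrict_space
         Diff_eq Int_commute subset_iff\<close>)
qed

lemma prob_space_sphere_measure: "prob_space (sphere_measure :: 'a::euclidean_space measure)"
proof
  have "{x \<in> ball 0 1 - {0::'a}. x /\<^sub>R norm x \<in> sphere 0 1} = ball 0 1 - {0}"
    by auto
  moreover have "emeasure lborel (ball (0::'a) 1 - {0}) = emeasure lborel (ball (0::'a) 1)"
    by (rule emeasure_Diff_null_set) auto
  moreover have "emeasure lborel (ball (0::'a) 1) \<noteq> 0"
    using open_not_negligible[of "ball (0::'a) 1"]
    by (auto simp: negligible_iff_null_sets null_sets_def)
  moreover have "emeasure lborel (ball (0::'a) 1) \<noteq> \<infinity>"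
    using emeasure_bounded_finite[of "ball (0::'a) 1"] by auto
  ultimately show "emeasure sphere_measure (space (sphere_measure :: 'a measure)) = 1"
    by (simp add: emeasure_sphere_measure top.not_eq_extremum ennreal_divide_self)
qed

lemma sphere_measure_orthogonal_invariant:
  fixes T :: "real ^ 'n::{finite,wellorder} \<Rightarrow> real ^ 'n::_"
  assumes T: "orthogonal_transformation T" and B: "B \<in> sets borel" "B \<subseteq> sphere 0 1"
  shows "emeasure sphere_measure (T ` B) = emeasure sphere_measure B"
proof -
  have lin: "linear T" and nT: "\<And>x. norm (T x) = norm x" and bT: "bij T"
    using T by (auto simp: orthogonal_transformation_linear orthogonal_transformation_norm
        orthogonal_transformation_bij)
  have inv: "orthogonal_transformation (inv T)"
    using T by (rule orthogonal_transformation_inv)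
  have borel_inv: "inv T \<in> borel_measurable borel"
    by (intro borel_measurable_continuous_onI linear_continuous_on linear_conv_bounded_linear[THEN iffD1]
        orthogonal_transformation_linear inv)
  have TB: "T ` B \<in> sets borel" "T ` B \<subseteq> sphere 0 1"
    using measurable_sets[OF borel_inv B(1)] B(2) nT bT
    by (auto simp: bij_vimage_eq_inv_image bij_imp_bij_inv inv_inv_eq)
  let ?K = "\<lambda>B. {x \<in> ball 0 1 - {0}. x /\<^sub>R norm x \<in> B}"
  have K: "?K B \<in> sets borel" if "B \<in> sets borel" for B :: "(real ^ 'n::_) set"
    using that by measurable
  have bounded: "bounded (?K B)" for B :: "(real ^ 'n::_) set"
    by (rule bounded_subset[OF bounded_ball[of 0 1]]) auto
  have fin: "emeasure lborel (?K B) \<noteq> \<infinity>" for B :: "(real ^ 'n::_) set"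
    using emeasure_bounded_finite[OF bounded[of B]] by (rule less_imp_neq)
  have TK: "?K (T ` B) = T ` ?K B"
  proof (intro equalityI subsetI)
    fix x assume x: "x \<in> ?K (T ` B)"
    then obtain b where b: "b \<in> B" "x /\<^sub>R norm x = T b" by auto
    have "T (norm x *\<^sub>R b) = norm x *\<^sub>R (x /\<^sub>R norm x)"
      by (simp only: linear_scale[OF lin] b(2))
    then have "x = T (norm x *\<^sub>R b)"
      using x by simp
    moreover have "norm x *\<^sub>R b \<in> ?K B"
      using x b B(2) by auto
    ultimately show "x \<in> T ` ?K B" by blast
  next
    fix y assume "y \<in> T ` ?K B"
    then obtain x where x: "y = T x" "x \<in> ?K B" by blast
    have "T x /\<^sub>R norm (T x) = T (x /\<^sub>R norm x)"
      by (simp add: nT linear_scale[OF lin])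
    moreover have "T x \<noteq> 0" using x nT[of x] by auto
    ultimately show "y \<in> ?K (T ` B)"
      using x by (auto simp: nT)
  qed
  have KB: "?K B \<in> sets lborel" and KTB: "?K (T ` B) \<in> sets lborel"
    unfolding sets_lborel by (fact K[OF B(1)], fact K[OF TB(1)])
  have "?K B \<in> lmeasurable"
    by (rule bounded_set_imp_lmeasurable[OF bounded[of B] sets_completionI_sets[OF KB]])
  then have "measure lebesgue (T ` ?K B) = measure lebesgue (?K B)"
    by (rule measure_orthogonal_image[OF T])
  then have "measure lborel (?K (T ` B)) = measure lborel (?K B)"
    unfolding TK[symmetric] measure_completion[OF KB] measure_completion[OF KTB] .
  then have "emeasure lborel (?K (T ` B)) = emeasure lborel (?K B)"
    using emeasure_eq_ennreal_measure[OF fin[of B, unfolded infinity_ennreal_def]]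
      emeasure_eq_ennreal_measure[OF fin[of "T ` B", unfolded infinity_ennreal_def]] by simp
  then show ?thesis
    by (simp add: emeasure_sphere_measure B TB)
qed

lemma sphere_derivative_unique:
  fixes f :: "'a::euclidean_space \<Rightarrow> real"
  assumes u: "u \<bullet> x = 0" "(f has_derivative (\<lambda>w. u \<bullet> w)) (at x within sphere 0 1)"
    and v: "v \<bullet> x = 0" "(f has_derivative (\<lambda>w. v \<bullet> w)) (at x within sphere 0 1)"
    and x: "norm x = 1"
  shows "u = v"
proof (rule ccontr)
  assume "u \<noteq> v"
  define w where "w = (u - v) /\<^sub>R norm (u - v)"
  have w: "norm w = 1" "w \<bullet> x = 0"
    using \<open>u \<noteq> v\<close> u v by (auto simp: w_def inner_diff_left)
  define \<gamma> where "\<gamma> t = cos t *\<^sub>R x + sin t *\<^sub>R w" for t :: real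
  have "(norm (\<gamma> t))\<^sup>2 = 1" for t
  proof -
    have "(norm (\<gamma> t))\<^sup>2 = (cos t)\<^sup>2 * (x \<bullet> x) + (sin t)\<^sup>2 * (w \<bullet> w)"
      using w(2) unfolding power2_norm_eq_inner
      by (simp add: \<gamma>_def inner_add_left inner_add_right inner_commute[of x w] power2_eq_square)
    then show ?thesis using x w by (simp add: norm_eq_1)
  qed
  then have \<gamma>: "\<gamma> ` UNIV \<subseteq> sphere 0 1"
    by (auto simp: power2_eq_1_iff) (smt (verit) norm_ge_zero)
  have \<gamma>0: "\<gamma> 0 = x" by (simp add: \<gamma>_def)
  have d\<gamma>: "(\<gamma> has_derivative (\<lambda>h. h *\<^sub>R w)) (at 0)"
    unfolding \<gamma>_def by (auto intro!: derivative_eq_intros)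
  have *: "((\<lambda>t. f (\<gamma> t)) has_derivative (\<lambda>h. z \<bullet> (h *\<^sub>R w))) (at 0)"
    if "(f has_derivative (\<lambda>w. z \<bullet> w)) (at x within sphere 0 1)" for z
    using has_derivative_in_compose[of \<gamma> "\<lambda>h. h *\<^sub>R w" 0 UNIV f "\<lambda>w. z \<bullet> w"]
      d\<gamma> that has_derivative_subset[OF that \<gamma>] by (simp add: \<gamma>0)
  have "u \<bullet> (1 *\<^sub>R w) = v \<bullet> (1 *\<^sub>R w)"
    using has_derivative_unique[OF *[OF u(2)] *[OF v(2)]] by metis
  then have "(u - v) \<bullet> w = 0" by (simp add: inner_diff_left)
  then show False
    using \<open>u \<noteq> v\<close> by (simp add: w_def)
qed

lemma sphere_grad_eq_tangential_part:
  fixes f g :: "'a::euclidean_space \<Rightarrow> real"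
  assumes x: "x \<in> sphere 0 1" and U: "open U" "x \<in> U"
    and eq: "\<And>y. y \<in> U \<inter> sphere 0 1 \<Longrightarrow> f y = g y"
    and g: "(g has_derivative (\<lambda>w. G \<bullet> w)) (at x)"
  shows "sphere_grad f x = G - (G \<bullet> x) *\<^sub>R x"
proof -
  let ?v = "G - (G \<bullet> x) *\<^sub>R x"
  have xx: "x \<bullet> x = 1" using x by (simp add: norm_eq_1)
  have q: "((\<lambda>y. (G \<bullet> x) * ((y \<bullet> y - 1) / 2)) has_derivative (\<lambda>w. (G \<bullet> x) * (x \<bullet> w))) (at x)"
    by (auto intro!: derivative_eq_intros simp: inner_commute)
  have "((\<lambda>y. g y - (G \<bullet> x) * ((y \<bullet> y - 1) / 2)) has_derivative (\<lambda>w. ?v \<bullet> w)) (at x)"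
    using has_derivative_diff[OF g q] by (simp add: inner_diff_left)
  then have "((\<lambda>y. g y - (G \<bullet> x) * ((y \<bullet> y - 1) / 2)) has_derivative (\<lambda>w. ?v \<bullet> w))
      (at x within sphere 0 1)"
    by (rule has_derivative_at_withinI)
  then have d: "(f has_derivative (\<lambda>w. ?v \<bullet> w)) (at x within sphere 0 1)"
  proof (rule has_derivative_transform_eventually)
    have "eventually (\<lambda>y. y \<in> U) (at x within sphere 0 1)"
      using U by (auto simp: eventually_at_topological)
    moreover have "eventually (\<lambda>y. y \<in> sphere 0 1) (at x within sphere (0::'a) 1)"
      by (auto simp: eventually_at_filter)
    ultimately show "\<forall>\<^sub>F y in at x within sphere 0 1. g y - (G \<bullet> x) * ((y \<bullet> y - 1) / 2) = f y"
      by eventually_elim (simp add: eq norm_eq_1)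
    show "g x - (G \<bullet> x) * ((x \<bullet> x - 1) / 2) = f x"
      using eq[of x] x U by (simp add: xx)
    show "x \<in> sphere 0 1" by (rule x)
  qed
  have o: "?v \<bullet> x = 0" by (simp add: inner_diff_left xx)
  show ?thesis
    unfolding sphere_grad_def
    by (rule the_equality) (use d o x sphere_derivative_unique in \<open>auto\<close>)
qed

end

theory Submission
  imports Defs
begin

text \<open>Write \<open>V = \<integral>g\<^sup>2\<close>, \<open>R = (\<integral>g)\<^sup>2 / V\<close> and \<open>E = \<integral>\<Gamma>(g)\<close>. Interpolating the norm with exponent \<open>2/p\<close> between
  those with exponents 1 and 2 turns the hypothesis into
  \<open>V * (1 - A * R powr (2 / (m - d))) \<le> 16 / ((m + 2 - d) * (3 * d - 2 + m)) * E\<close>. Since \<open>c(m,d)\<close> is at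
  least a multiple of \<open>m powr (-d/2)\<close>, taking \<open>m\<close> proportional to \<open>R powr (-2/d)\<close> gives the Nash inequality
  \<open>V \<le> C * R powr (2/d) * (V + E)\<close>. Applied to the truncations of \<open>f\<close> at all dyadic levels it yields
  a Sobolev inequality with some constant in front of \<open>\<integral>f\<^sup>2\<close>. The truncations must be smooth here, so
  rational functions of \<open>f\<close> are used instead of cut-offs. The constant is
  brought down to 1 by expanding \<open>\<bar>M + h\<bar> powr q\<close> around the mean \<open>M\<close> of \<open>f\<close> and by the Poincare
  inequality, the case \<open>m = d + 2\<close>, where \<open>c(d,d) = 2 * c(d+2,d)\<close> makes \<open>A = 1\<close>.\<close>

subsection \<open>Smooth functions and gradients on the sphere\<close>

text \<open>On an open set, agreement of two functions passes to their derivatives, so the induction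
  can pass to one derivative at a time.\<close>

lemma C_k_on_cong:
  assumes "open U" "\<And>x. x \<in> U \<Longrightarrow> f x = g x" "C_k_on k f U"
  shows "C_k_on k g U"
  using assms(2,3)
proof (induction k arbitrary: f g)
  case 0
  then show ?case by (metis C_k_on.simps(1) continuous_on_cong)
next
  case (Suc k)
  have ev: "eventually (\<lambda>y. f y = g y) (nhds x)" if "x \<in> U" for x
    using that assms(1) Suc.prems(1) by (auto simp: eventually_nhds)
  have hd: "(g has_derivative frechet_derivative f (at x)) (at x)" if "x \<in> U" for x
  proof -
    have "(f has_derivative frechet_derivative f (at x)) (at x)"
      using Suc.prems(2) that by (simp add: frechet_derivative_works)
    then show ?thesis
      by (rule has_derivative_transform_within_open[OF _ assms(1) that]) (use Suc.prems in auto)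
  qed
  show ?case
  proof (simp, intro conjI ballI allI)
    fix x assume "x \<in> U" then show "g differentiable (at x)"
      using hd differentiable_def by blast
  next
    fix v
    show "C_k_on k (\<lambda>x. frechet_derivative g (at x) v) U"
      by (rule Suc.IH[of "\<lambda>x. frechet_derivative f (at x) v"])
         (use Suc.prems frechet_derivative_at[OF hd] in auto)
  qed
qed

lemma C_k_on_subset: "C_k_on k f U \<Longrightarrow> V \<subseteq> U \<Longrightarrow> C_k_on k f V"
  by (induction k arbitrary: f) (auto intro: continuous_on_subset)

lemma C_k_on_Suc_imp: "C_k_on (Suc k) f U \<Longrightarrow> C_k_on k f U"
proof (induction k arbitrary: f)
  case 0
  then show ?case
    by (simp add: continuous_at_imp_continuous_on differentiable_imp_continuous_within)
next
  case (Suc k)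
  then show ?case by (metis C_k_on.simps(2))
qed

lemma C_k_on_const: "C_k_on k (\<lambda>_. c) U"
  by (induction k arbitrary: c) auto

text \<open>Replaces \<open>frechet_derivative\<close> by an explicit derivative, so that the
  inductions below can use the product and quotient rules as formulas.\<close>

lemma C_k_on_SucI:
  assumes "open U" "\<And>x. x \<in> U \<Longrightarrow> (f has_derivative f' x) (at x)"
    and "\<And>v. C_k_on k (\<lambda>x. f' x v) U"
  shows "C_k_on (Suc k) f U"
proof (simp, intro conjI ballI allI)
  fix x assume "x \<in> U" then show "f differentiable (at x)"
    using assms(2) differentiable_def by blast
next
  fix v
  show "C_k_on k (\<lambda>x. frechet_derivative f (at x) v) U"
    by (rule C_k_on_cong[OF assms(1) _ assms(3)])
      (simp add: frechet_derivative_at[OF assms(2), symmetric])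
qed

lemma C_k_on_add:
  assumes "open U" "C_k_on k f U" "C_k_on k g U"
  shows "C_k_on k (\<lambda>x. f x + g x) U"
  using assms(2,3)
proof (induction k arbitrary: f g)
  case 0
  then show ?case by (auto intro: continuous_intros)
next
  case (Suc k)
  show ?case
  proof (rule C_k_on_SucI[OF assms(1)])
    fix x assume "x \<in> U"
    then show "((\<lambda>x. f x + g x) has_derivative
        (\<lambda>v. frechet_derivative f (at x) v + frechet_derivative g (at x) v)) (at x)"
      using Suc.prems by (intro has_derivative_add) (auto simp: frechet_derivative_works)
  qed (use Suc in auto)
qed

lemma C_k_on_mult:
  assumes "open U" "C_k_on k f U" "C_k_on k g U"
  shows "C_k_on k (\<lambda>x. f x * g x) U"
  using assms(2,3)
proof (induction k arbitrary: f g)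
  case 0
  then show ?case by (auto intro: continuous_intros)
next
  case (Suc k)
  show ?case
  proof (rule C_k_on_SucI[OF assms(1)])
    fix x assume "x \<in> U"
    then show "((\<lambda>x. f x * g x) has_derivative
        (\<lambda>v. f x * frechet_derivative g (at x) v + frechet_derivative f (at x) v * g x)) (at x)"
      using Suc.prems by (intro has_derivative_mult) (auto simp: frechet_derivative_works)
  next
    fix v show "C_k_on k (\<lambda>x. f x * frechet_derivative g (at x) v +
        frechet_derivative f (at x) v * g x) U"
      \<comment> \<open>The product rule leaves one factor undifferentiated;
        \<open>C_k_on_Suc_imp\<close> lowers its order so that the induction hypothesis
        applies.\<close>
      using Suc.prems C_k_on_Suc_imp by (intro C_k_on_add assms(1) Suc.IH) auto
  qed
qed

text \<open>The derivative of the reciprocal is a product of the reciprocal itself, which has order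
  \<open>k\<close> by induction, and a derivative of \<open>f\<close>.\<close>

lemma C_k_on_inverse:
  assumes "open U" "C_k_on k f U" "\<And>x. x \<in> U \<Longrightarrow> f x \<noteq> 0"
  shows "C_k_on k (\<lambda>x. inverse (f x)) U"
  using assms(2)
proof (induction k)
  case 0
  then show ?case using assms(3) by (auto intro: continuous_intros)
next
  case (Suc k)
  show ?case
  proof (rule C_k_on_SucI[OF assms(1)])
    fix x assume "x \<in> U"
    then show "((\<lambda>x. inverse (f x)) has_derivative
        (\<lambda>v. - 1 * (inverse (f x) * (frechet_derivative f (at x) v * inverse (f x))))) (at x)"
      using Suc.prems assms(3)
      by (auto simp: frechet_derivative_works mult.assoc intro!: derivative_eq_intros)
  next
    fix v
    have "C_k_on k (\<lambda>x. inverse (f x)) U"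
      using Suc C_k_on_Suc_imp by blast
    then show "C_k_on k (\<lambda>x. - 1 * (inverse (f x) *
        (frechet_derivative f (at x) v * inverse (f x)))) U"
      using Suc.prems by (intro C_k_on_mult assms(1) C_k_on_const) auto
  qed
qed

section \<open>Algebra of smooth functions on the sphere\<close>

lemma smooth_on_sphere_const: "smooth_on_sphere (\<lambda>_. c)"
  unfolding smooth_on_sphere_def using C_k_on_const open_UNIV by blast

lemma smooth_on_sphere_binary:
  fixes f g :: "'a::euclidean_space \<Rightarrow> real"
  assumes f: "smooth_on_sphere f" and g: "smooth_on_sphere g"
    and H: "\<And>k (U :: 'a set) u v. open U \<Longrightarrow> C_k_on k u U \<Longrightarrow> C_k_on k v U \<Longrightarrow> C_k_on k (\<lambda>x. H (u x) (v x)) U"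
  shows "smooth_on_sphere (\<lambda>x. H (f x) (g x))"
  unfolding smooth_on_sphere_def
proof
  fix x :: 'a assume x: "x \<in> sphere 0 1"
  obtain U u where u: "open U" "x \<in> U" "\<And>k. C_k_on k u U" "\<And>y. y \<in> U \<inter> sphere 0 1 \<Longrightarrow> f y = u y"
    using f x unfolding smooth_on_sphere_def by metis
  obtain V v where v: "open V" "x \<in> V" "\<And>k. C_k_on k v V" "\<And>y. y \<in> V \<inter> sphere 0 1 \<Longrightarrow> g y = v y"
    using g x unfolding smooth_on_sphere_def by metis
  have o: "open (U \<inter> V)" using u v by auto
  have "C_k_on k u (U \<inter> V)" "C_k_on k v (U \<inter> V)" for k
    using C_k_on_subset[OF u(3)] C_k_on_subset[OF v(3)] by auto
  then have "C_k_on k (\<lambda>x. H (u x) (v x)) (U \<inter> V)" for k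
    using H[OF o] by blast
  then show "\<exists>U h. open U \<and> x \<in> U \<and> (\<forall>k. C_k_on k h U) \<and>
      (\<forall>y\<in>U \<inter> sphere 0 1. H (f y) (g y) = h y)"
    using o u v by (intro exI[of _ "U \<inter> V"] exI[of _ "\<lambda>x. H (u x) (v x)"]) auto
qed

lemma smooth_on_sphere_add:
  "smooth_on_sphere f \<Longrightarrow> smooth_on_sphere g \<Longrightarrow> smooth_on_sphere (\<lambda>x. f x + g x)"
  by (rule smooth_on_sphere_binary) (auto intro: C_k_on_add)

lemma smooth_on_sphere_mult:
  "smooth_on_sphere f \<Longrightarrow> smooth_on_sphere g \<Longrightarrow> smooth_on_sphere (\<lambda>x. f x * g x)"
  by (rule smooth_on_sphere_binary) (auto intro: C_k_on_mult)

lemma smooth_on_sphere_power: "smooth_on_sphere f \<Longrightarrow> smooth_on_sphere (\<lambda>x. f x ^ n)"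
  by (induction n) (auto intro: smooth_on_sphere_mult smooth_on_sphere_const)

lemma smooth_on_sphere_inverse:
  assumes f: "smooth_on_sphere f" and nz: "\<And>x. x \<in> sphere 0 1 \<Longrightarrow> f x \<noteq> 0"
  shows "smooth_on_sphere (\<lambda>x. inverse (f x))"
  unfolding smooth_on_sphere_def
proof
  fix x :: 'a assume x: "x \<in> sphere 0 1"
  obtain U u where u: "open U" "x \<in> U" "\<And>k. C_k_on k u U" "\<And>y. y \<in> U \<inter> sphere 0 1 \<Longrightarrow> f y = u y"
    using f x unfolding smooth_on_sphere_def by metis
  \<comment> \<open>\<open>f\<close> is nonzero on the sphere only; its local extension
    \<open>u\<close> may vanish nearby, so the neighbourhood is shrunk.\<close>
  define V where "V = {y \<in> U. u y \<noteq> 0}"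
  have "continuous_on U u" using u(3)[of 0] by simp
  then have o: "open V"
  proof -
    have "V = U \<inter> u -` (- {0})" by (auto simp: V_def)
    then show ?thesis
      using continuous_open_preimage[OF \<open>continuous_on U u\<close> u(1), of "- {0}"] by auto
  qed
  have "C_k_on k (\<lambda>x. inverse (u x)) V" for k
    by (rule C_k_on_inverse[OF o C_k_on_subset[OF u(3)]]) (auto simp: V_def)
  moreover have "x \<in> V" using u(2) u(4)[of x] x nz[OF x] by (simp add: V_def)
  ultimately show "\<exists>U h. open U \<and> x \<in> U \<and> (\<forall>k. C_k_on k h U) \<and>
      (\<forall>y\<in>U \<inter> sphere 0 1. inverse (f y) = h y)"
    using o u by (intro exI[of _ V] exI[of _ "\<lambda>x. inverse (u x)"]) (auto simp: V_def)
qed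

section \<open>Ambient gradients and the carre du champ\<close>

text \<open>Supplies the data for \<open>sphere_grad_eq_tangential_part\<close>, so that
  \<open>sphere_grad\<close>, defined by a description, can be computed from a continuous ambient
  gradient.\<close>

lemma smooth_on_sphere_local_gradient:
  fixes f :: "'a::euclidean_space \<Rightarrow> real"
  assumes f: "smooth_on_sphere f" and x: "x \<in> sphere 0 1"
  obtains U g G where "open U" "x \<in> U" "continuous_on U G" "continuous_on U g"
    "\<And>y. y \<in> U \<inter> sphere 0 1 \<Longrightarrow> f y = g y"
    "\<And>y. y \<in> U \<Longrightarrow> (g has_derivative (\<lambda>w. G y \<bullet> w)) (at y)"
proof -
  obtain U g where g: "open U" "x \<in> U" "\<And>k. C_k_on k g U" "\<And>y. y \<in> U \<inter> sphere 0 1 \<Longrightarrow> f y = g y"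
    using f x unfolding smooth_on_sphere_def by metis
  define G where "G y = (\<Sum>b\<in>Basis. frechet_derivative g (at y) b *\<^sub>R b)" for y
  have "continuous_on U (\<lambda>y. frechet_derivative g (at y) b)" for b
    using g(3)[of "Suc 0"] by simp
  then have cG: "continuous_on U G"
    unfolding G_def by (intro continuous_intros)
  have "(g has_derivative (\<lambda>w. G y \<bullet> w)) (at y)" if "y \<in> U" for y
  proof -
    have D: "(g has_derivative frechet_derivative g (at y)) (at y)"
      using g(3)[of "Suc 0"] that by (simp add: frechet_derivative_works)
    have "frechet_derivative g (at y) w = G y \<bullet> w" for w
    proof -
      have "frechet_derivative g (at y) w = frechet_derivative g (at y) (\<Sum>b\<in>Basis. (w \<bullet> b) *\<^sub>R b)"
        by (simp add: euclidean_representation)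
      also have "\<dots>
          = (\<Sum>b\<in>Basis. (w \<bullet> b) * frechet_derivative g (at y) b)"
        using has_derivative_linear[OF D] by (simp add: linear_sum linear_scale)
      also have "\<dots> = G y \<bullet> w"
        by (simp add: G_def inner_sum_left mult.commute inner_commute[of w])
      finally show ?thesis .
    qed
    then have "frechet_derivative g (at y) = (\<lambda>w. G y \<bullet> w)" by (rule ext)
    then show ?thesis using D by simp
  qed
  moreover have "continuous_on U g" using g(3)[of 0] by simp
  ultimately show ?thesis
    by (intro that[OF g(1,2) cG _ g(4)])
qed

lemma smooth_on_sphere_imp_continuous:
  assumes "smooth_on_sphere f"
  shows "continuous_on (sphere 0 1) f"
  unfolding continuous_on_eq_continuous_within
proof
  fix x :: 'a assume x: "x \<in> sphere 0 1"
  obtain U g G where g: "open U" "x \<in> U" "continuous_on U G" "continuous_on U g"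
    "\<And>y. y \<in> U \<inter> sphere 0 1 \<Longrightarrow> f y = g y"
    "\<And>y. y \<in> U \<Longrightarrow> (g has_derivative (\<lambda>w. G y \<bullet> w)) (at y)"
    using smooth_on_sphere_local_gradient[OF assms x] by metis
  have "continuous (at x within sphere 0 1) g"
    using continuous_on_eq_continuous_at[OF g(1)] g(2,4) continuous_at_imp_continuous_at_within
    by blast
  then show "continuous (at x within sphere 0 1) f"
  proof (rule continuous_transform_within_openin)
    show "openin (top_of_set (sphere 0 1)) (sphere 0 1 \<inter> U)" using g by auto
  qed (use g x in auto)
qed

text \<open>Near each point the carre du champ is the squared norm of the tangential part of a
  continuous ambient gradient.\<close>

lemma continuous_on_carre_du_champ:
  assumes "smooth_on_sphere f"
  shows "continuous_on (sphere 0 1) (carre_du_champ f)"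
  unfolding continuous_on_eq_continuous_within
proof
  fix x :: 'a assume x: "x \<in> sphere 0 1"
  obtain U g G where g: "open U" "x \<in> U" "continuous_on U G" "continuous_on U g"
    "\<And>y. y \<in> U \<inter> sphere 0 1 \<Longrightarrow> f y = g y"
    "\<And>y. y \<in> U \<Longrightarrow> (g has_derivative (\<lambda>w. G y \<bullet> w)) (at y)"
    using smooth_on_sphere_local_gradient[OF assms x] by metis
  let ?c = "\<lambda>y. (norm (G y - (G y \<bullet> y) *\<^sub>R y))\<^sup>2"
  have eq: "?c y = carre_du_champ f y" if "y \<in> U \<inter> sphere 0 1" for y
    using sphere_grad_eq_tangential_part[of y U f g "G y"] that g by (auto simp: carre_du_champ_def)
  have "continuous_on U ?c" using g by (intro continuous_intros) auto
  then have "continuous (at x within sphere 0 1) ?c"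
    using continuous_on_eq_continuous_at[OF g(1)] g(2) continuous_at_imp_continuous_at_within
    by blast
  then show "continuous (at x within sphere 0 1) (carre_du_champ f)"
  proof (rule continuous_transform_within_openin)
    show "openin (top_of_set (sphere 0 1)) (sphere 0 1 \<inter> U)" using g by auto
  qed (use g x eq in auto)
qed

lemma carre_du_champ_nonneg: "0 \<le> carre_du_champ f x"
  by (simp add: carre_du_champ_def)

text \<open>Composing a local extension with \<phi> multiplies its ambient gradient at
  \<open>x\<close> by \<open>D\<close>, and the tangential projection is linear.\<close>

lemma carre_du_champ_chain:
  fixes f :: "'a::euclidean_space \<Rightarrow> real"
  assumes "smooth_on_sphere f" "x \<in> sphere 0 1" "(\<phi> has_real_derivative D) (at (f x))"
  shows "carre_du_champ (\<lambda>y. \<phi> (f y)) x = D\<^sup>2 * carre_du_champ f x"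
proof -
  obtain U g G where g: "open U" "x \<in> U" "continuous_on U G" "continuous_on U g"
    "\<And>y. y \<in> U \<inter> sphere 0 1 \<Longrightarrow> f y = g y"
    "\<And>y. y \<in> U \<Longrightarrow> (g has_derivative (\<lambda>w. G y \<bullet> w)) (at y)"
    using smooth_on_sphere_local_gradient[OF assms(1,2)] by metis
  have fx: "f x = g x" using g assms by auto
  have G: "sphere_grad f x = G x - (G x \<bullet> x) *\<^sub>R x"
    using g by (intro sphere_grad_eq_tangential_part[OF assms(2), of U f g]) auto
  have "((\<lambda>y. \<phi> (g y)) has_derivative (\<lambda>w. D * (G x \<bullet> w))) (at x)"
    using has_derivative_compose[OF g(6)[OF g(2)], of \<phi> "(*) D"] assms(3) fx
    by (simp add: has_field_derivative_def)
  then have "((\<lambda>y. \<phi> (g y)) has_derivative (\<lambda>w. (D *\<^sub>R G x) \<bullet> w)) (at x)"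
    by simp
  then have "sphere_grad (\<lambda>y. \<phi> (f y)) x = D *\<^sub>R G x - ((D *\<^sub>R G x) \<bullet> x) *\<^sub>R x"
    using g by (intro sphere_grad_eq_tangential_part[OF assms(2), of U _ "\<lambda>y. \<phi> (g y)"]) auto
  also have "\<dots> = D *\<^sub>R sphere_grad f x"
    by (simp add: G algebra_simps)
  finally show ?thesis
    by (simp add: carre_du_champ_def power_mult_distrib)
qed

lemma integrable_sphere_measure:
  fixes f :: "'a::euclidean_space \<Rightarrow> real"
  assumes "continuous_on (sphere 0 1) f"
  shows "integrable sphere_measure f"
proof -
  interpret prob_space "sphere_measure :: 'a measure" by (rule prob_space_sphere_measure)
  have "compact (f ` sphere 0 1)"
    using assms compact_continuous_image compact_sphere by blast
  then obtain B where "\<And>x. x \<in> sphere 0 1 \<Longrightarrow> norm (f x) \<le> B"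
    by (meson bounded_iff compact_imp_bounded image_eqI)
  moreover have "f \<in> borel_measurable sphere_measure"
    using borel_measurable_continuous_on_restrict[OF assms]
      measurable_cong_sets[OF sets_sphere_measure refl] by blast
  ultimately show ?thesis
    by (intro integrable_const_bound[of _ B]) auto
qed

subsection \<open>The constants \<open>c(m,d)\<close>\<close>

text \<open>This is \<open>c_const m 1\<close> for \<open>m = 2 * s - 1\<close>. Integrating out one
  coordinate at a time factors every \<open>c_const m d\<close> into such integrals, and the facts
  about Gamma quotients become facts about these factors.\<close>

definition bell_integral :: "real \<Rightarrow> real" where
  "bell_integral s = (\<integral>y. (1 + y\<^sup>2) powr (- s) \<partial>lborel)"

lemma bell_integral_nonneg: "0 \<le> bell_integral s"
  by (simp add: bell_integral_def)

text \<open>Comparison with the derivative of arctan, which is the case \<open>s = 1\<close>. The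
  exponents occurring in \<open>c_const m d\<close> with \<open>1 \<le> m\<close> are all at least
  1.\<close>

lemma integrable_bell:
  assumes "1 \<le> s"
  shows "integrable lborel (\<lambda>y::real. (1 + y\<^sup>2) powr (- s))"
proof -
  have "set_integrable lborel (einterval (-\<infinity>) \<infinity>) (\<lambda>y::real. inverse (1 + y\<^sup>2))"
  proof (rule interval_integral_FTC_nonneg)
    show "((arctan \<circ> real_of_ereal) \<longlongrightarrow> - (pi / 2)) (at_right (- \<infinity>))"
      "((arctan \<circ> real_of_ereal) \<longlongrightarrow> pi / 2) (at_left \<infinity>)"
      using tendsto_arctan_at_bot tendsto_arctan_at_top by (simp_all add: ereal_tendsto_simps)
    fix x :: real
    have "1 + x\<^sup>2 \<noteq> 0" by (smt (verit) zero_le_power2)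
    then show "isCont (\<lambda>y. inverse (1 + y\<^sup>2)) x" by (intro continuous_intros)
  qed (auto intro: DERIV_arctan)
  then have i: "integrable lborel (\<lambda>y::real. inverse (1 + y\<^sup>2))"
    by (simp add: set_integrable_def einterval_iff)
  show ?thesis
  proof (rule Bochner_Integration.integrable_bound[OF i])
    have "(1 + y\<^sup>2) powr (- s) \<le> inverse (1 + y\<^sup>2)" for y :: real
    proof -
      have "(1 + y\<^sup>2) powr (- s) \<le> (1 + y\<^sup>2) powr (- 1)"
        using assms by (intro powr_mono) auto
      also have "\<dots> = inverse (1 + y\<^sup>2)"
        by (subst powr_minus) (simp add: add_nonneg_eq_0_iff abs_if not_less)
      finally show ?thesis .
    qed
    then show "AE y in lborel. norm ((1 + y\<^sup>2) powr (- s)) \<le> norm (inverse (1 + y\<^sup>2::real))"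
      by simp
  qed measurable
qed

lemma nn_integral_bell:
  assumes "1 \<le> s"
  shows "(\<integral>\<^sup>+y. ennreal ((1 + y\<^sup>2) powr (- s)) \<partial>lborel) = ennreal (bell_integral s)"
  unfolding bell_integral_def by (rule nn_integral_eq_integral[OF integrable_bell[OF assms]]) simp

text \<open>The derivative of \<open>y * (1 + y\<^sup>2) powr (- s)\<close> has integral zero, as
  this function vanishes at both infinities. It is the counterpart of the functional equation of
  Gamma.\<close>

lemma bell_integral_Suc:
  assumes "1 \<le> s"
  shows "(2 * s - 1) * bell_integral s = 2 * s * bell_integral (s + 1)"
proof -
  define F where "F y = y * (1 + y\<^sup>2) powr (- s)" for y :: real
  define f where "f y = (1 - 2 * s) * (1 + y\<^sup>2) powr (- s) + 2 * s * (1 + y\<^sup>2) powr (- (s + 1))"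
    for y :: real
  have pos: "0 < 1 + y\<^sup>2" for y :: real by (smt (verit) zero_le_power2)
  have D: "(F has_real_derivative f y) (at y)" for y
  proof -
    have "(F has_real_derivative (1 + y\<^sup>2) powr (- s)
        - 2 * s * (y\<^sup>2 * (1 + y\<^sup>2) powr (- s - 1))) (at y)"
      unfolding F_def
      by (auto intro!: derivative_eq_intros simp: pos less_imp_neq[OF pos, symmetric] power2_eq_square[of y, symmetric])
    \<comment> \<open>Writing \<open>y\<^sup>2\<close> as \<open>(1 + y\<^sup>2) - 1\<close> turns
      the derivative into a combination of the two integrands in question.\<close>
    moreover have "y\<^sup>2 * (1 + y\<^sup>2) powr (- s - 1) = (1 + y\<^sup>2) powr (- s) - (1 + y\<^sup>2) powr (- s - 1)"
    proof -
      have "(1 + y\<^sup>2) powr (- s) = (1 + y\<^sup>2) * (1 + y\<^sup>2) powr (- s - 1)"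
        using powr_mult_base[of "1 + y\<^sup>2" "- s - 1"] pos[of y] by simp
      then show ?thesis by (simp add: algebra_simps)
    qed
    moreover have "- (s + 1) = - s - 1" by simp
    ultimately show ?thesis
      unfolding f_def by (simp only:) (simp add: algebra_simps)
  qed
  have C: "isCont f y" for y
    unfolding f_def using pos[of y] by (intro continuous_intros) auto
  have I: "integrable lborel f"
    unfolding f_def using assms
    by (intro Bochner_Integration.integrable_add integrable_mult_right integrable_bell[of s]
          integrable_bell[of "s + 1"]) auto
  have bound: "norm (F y) \<le> norm (inverse y)" if "y \<noteq> 0" for y
  proof -
    have "(1 + y\<^sup>2) powr (- s) \<le> (1 + y\<^sup>2) powr (- 1)"
      using assms by (intro powr_mono) auto
    also have "\<dots> = inverse (1 + y\<^sup>2)"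
      using pos[of y] by (subst powr_minus) simp
    also have "\<dots> \<le> inverse (y\<^sup>2)"
      using that by (intro le_imp_inverse_le) auto
    finally have "\<bar>y\<bar> * (1 + y\<^sup>2) powr (- s) \<le> \<bar>y\<bar> * inverse (y\<^sup>2)"
      by (intro mult_left_mono) auto
    also have "\<dots> = \<bar>inverse y\<bar>"
      using that by (simp add: power2_eq_square field_simps abs_if)
    finally show ?thesis by (simp add: F_def abs_mult)
  qed
  have inf: "(F \<longlongrightarrow> 0) at_infinity"
  proof (rule Lim_null_comparison)
    show "\<forall>\<^sub>F y in at_infinity. norm (F y) \<le> norm (inverse y)"
      using eventually_not_equal_at_infinity[of 0] by eventually_elim (rule bound)
    show "((\<lambda>y::real. norm (inverse y)) \<longlongrightarrow> 0) at_infinity"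
      by (intro tendsto_norm_zero tendsto_inverse_0)
  qed
  have top: "(F \<longlongrightarrow> 0) at_top" and bot: "(F \<longlongrightarrow> 0) at_bot"
    using tendsto_mono[OF at_top_le_at_infinity inf] tendsto_mono[OF at_bot_le_at_infinity inf] by auto
  have "(LBINT y=-\<infinity>..\<infinity>. f y) = 0 - 0"
  proof (rule interval_integral_FTC_integrable)
    show "((F \<circ> real_of_ereal) \<longlongrightarrow> 0) (at_right (- \<infinity>))" "((F \<circ> real_of_ereal) \<longlongrightarrow> 0) (at_left \<infinity>)"
      using top bot by (simp_all add: ereal_tendsto_simps)
  qed (use D C I in \<open>auto simp: has_real_derivative_iff_has_vector_derivative set_integrable_def einterval_iff\<close>)
  then have "integral\<^sup>L lborel f = 0"
    by (simp add: interval_lebesgue_integral_def set_lebesgue_integral_def einterval_iff)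
  moreover have "integral\<^sup>L lborel f = (1 - 2 * s) * bell_integral s + 2 * s * bell_integral (s + 1)"
    unfolding f_def bell_integral_def using assms
    by (subst Bochner_Integration.integral_add[OF integrable_mult_right[OF integrable_bell[of s]]
          integrable_mult_right[OF integrable_bell[of "s + 1"]]]) auto
  ultimately show ?thesis by (simp add: algebra_simps)
qed

text \<open>On the interval from 0 to \<open>1 / sqrt s\<close> the integrand is at least
  \<open>exp (- 1)\<close>, because
  \<open>s * ln (1 + y\<^sup>2) \<le> s * y\<^sup>2 \<le> 1\<close> there.\<close>

lemma bell_integral_ge:
  assumes "1 \<le> s"
  shows "exp (- 1) / sqrt s \<le> bell_integral s"
proof -
  have s: "0 < sqrt s" using assms by simp
  have "exp (- 1) / sqrt s = (\<integral>y. exp (- 1) * indicator {0..1 / sqrt s} y \<partial>lborel)"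
    using s by simp
  also have "\<dots> \<le> bell_integral s"
    unfolding bell_integral_def
  proof (rule integral_mono[OF _ integrable_bell[OF assms]])
    show "integrable lborel (\<lambda>y. exp (- 1) * indicator {0..1 / sqrt s} y :: real)"
      by (intro integrable_mult_right) (simp add: integrable_indicator_iff emeasure_lborel_Icc_eq)
    fix y :: real
    show "exp (- 1) * indicator {0..1 / sqrt s} y \<le> (1 + y\<^sup>2) powr (- s)"
    proof (cases "y \<in> {0..1 / sqrt s}")
      case True
      then have "y\<^sup>2 \<le> (1 / sqrt s)\<^sup>2" by (intro power_mono) auto
      then have y: "s * y\<^sup>2 \<le> 1" using assms by (simp add: power_divide field_simps)
      have pos: "0 < 1 + y\<^sup>2" by (smt (verit) zero_le_power2)
      have "s * ln (1 + y\<^sup>2) \<le> s * y\<^sup>2"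
        using assms ln_add_one_self_le_self[of "y\<^sup>2"] by (intro mult_left_mono) auto
      then have "exp (- 1) \<le> exp (- s * ln (1 + y\<^sup>2))" using y by simp
      also have "\<dots> = (1 + y\<^sup>2) powr (- s)" using pos by (simp add: powr_def)
      finally show ?thesis using True by simp
    qed simp
  qed
  finally show ?thesis .
qed

lemma nn_integral_bell_scaled:
  assumes "1 \<le> s" "0 < b"
  shows "(\<integral>\<^sup>+y. ennreal ((b + y\<^sup>2) powr (- s)) \<partial>lborel) = ennreal (b powr (1/2 - s) * bell_integral s)"
proof -
  have *: "(b + (0 + sqrt b * y)\<^sup>2) powr (- s) = b powr (- s) * (1 + y\<^sup>2) powr (- s)" for y
  proof -
    have "b + (0 + sqrt b * y)\<^sup>2 = b * (1 + y\<^sup>2)"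
      using assms by (simp add: power_mult_distrib algebra_simps)
    then show ?thesis using assms by (simp add: powr_mult)
  qed
  have "(\<integral>\<^sup>+y. ennreal ((b + y\<^sup>2) powr (- s)) \<partial>lborel) =
      ennreal (sqrt b) * (\<integral>\<^sup>+y. ennreal (b powr (- s)) * ennreal ((1 + y\<^sup>2) powr (- s)) \<partial>lborel)"
    using assms by (subst nn_integral_real_affine[where c="sqrt b" and t=0])
      (simp_all only: *, simp_all add: ennreal_mult)
  also have "\<dots> = ennreal (sqrt b) * (ennreal (b powr (- s)) * ennreal (bell_integral s))"
    by (subst nn_integral_cmult) (simp_all add: nn_integral_bell assms)
  also have "\<dots> = ennreal (sqrt b * b powr (- s) * bell_integral s)"
    using assms bell_integral_nonneg by (simp add: ennreal_mult mult.assoc)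
  also have "sqrt b * b powr (- s) = b powr (1/2 - s)"
    using assms by (simp add: powr_half_sqrt[symmetric] powr_add[symmetric])
  finally show ?thesis .
qed

text \<open>Integrating out one coordinate leaves an integrand of the same shape with
  \<open>s\<close> lowered by 1/2. The bound on \<open>s\<close> keeps every exponent met on the way
  at least 1.\<close>

lemma nn_integral_bell_product:
  fixes I :: "nat set"
  assumes "finite I" "(real (card I) + 1) / 2 \<le> s" "0 < a"
  shows "(\<integral>\<^sup>+y. ennreal ((a + (\<Sum>i\<in>I. (y i)\<^sup>2)) powr (- s)) \<partial>(Pi\<^sub>M I (\<lambda>_. lborel))) =
    ennreal (a powr (real (card I) / 2 - s) * (\<Prod>j<card I. bell_integral (s - real j / 2)))"
  using assms
proof (induction I arbitrary: s rule: finite_induct)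
  case empty
  then show ?case by (simp add: nn_integral_count_space_finite PiM_empty)
next
  case (insert i I)
  interpret product_sigma_finite "\<lambda>_. lborel :: real measure" by standard
  have s: "1 \<le> s" using insert by (simp add: field_simps)
  have [measurable]: "(\<lambda>y. ennreal ((a + (\<Sum>j\<in>insert i I. (y j)\<^sup>2)) powr (- s)))
      \<in> borel_measurable (Pi\<^sub>M (insert i I) (\<lambda>_. lborel))"
    by measurable
  have sumI: "(\<Sum>j\<in>I. ((x(i := y)) j)\<^sup>2) = (\<Sum>j\<in>I. (x j)\<^sup>2)" for x :: "nat \<Rightarrow> real" and y
    using insert.hyps by (intro sum.cong) auto
  have pos: "0 < a + (\<Sum>j\<in>I. (x j)\<^sup>2)" for x :: "nat \<Rightarrow> real"
    using insert.prems by (simp add: add_pos_nonneg sum_nonneg)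
  have "(\<integral>\<^sup>+y. ennreal ((a + (\<Sum>j\<in>insert i I. (y j)\<^sup>2)) powr (- s)) \<partial>(Pi\<^sub>M (insert i I) (\<lambda>_. lborel))) =
      (\<integral>\<^sup>+x. (\<integral>\<^sup>+y. ennreal ((a + (\<Sum>j\<in>I. (x j)\<^sup>2) + y\<^sup>2) powr (- s)) \<partial>lborel) \<partial>(Pi\<^sub>M I (\<lambda>_. lborel)))"
    using insert.hyps
    by (subst product_nn_integral_insert) (simp_all add: sumI algebra_simps del: fun_upd_apply, simp_all add: fun_upd_same algebra_simps)
  also have "\<dots> = (\<integral>\<^sup>+x. ennreal (bell_integral s) *
        ennreal ((a + (\<Sum>j\<in>I. (x j)\<^sup>2)) powr (- (s - 1/2))) \<partial>(Pi\<^sub>M I (\<lambda>_. lborel)))"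
    using nn_integral_bell_scaled[OF s pos] bell_integral_nonneg
    by (simp add: ennreal_mult[symmetric] mult.commute)
  also have "\<dots> = ennreal (bell_integral s) *
      ennreal (a powr (real (card I) / 2 - (s - 1/2)) * (\<Prod>j<card I. bell_integral (s - 1/2 - real j / 2)))"
    using insert.prems insert.hyps
    by (subst nn_integral_cmult) (simp_all add: insert.IH field_simps)
  also have "\<dots> = ennreal (a powr (real (card (insert i I)) / 2 - s) *
      (bell_integral s * (\<Prod>j<card I. bell_integral (s - 1/2 - real j / 2))))"
    using insert.hyps bell_integral_nonneg
    by (simp add: ennreal_mult[symmetric] prod_nonneg field_simps)
  \<comment> \<open>The lowered exponent \<open>s - 1/2 - j/2\<close> belongs to factor
    \<open>j + 1\<close> of the new product; the factor 0 is \<open>bell_integral s\<close>.\<close>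
  also have "bell_integral s * (\<Prod>j<card I. bell_integral (s - 1/2 - real j / 2)) =
      (\<Prod>j<card (insert i I). bell_integral (s - real j / 2))"
  proof -
    have "(\<Prod>j<card I. bell_integral (s - 1/2 - real j / 2)) =
        (\<Prod>j<card I. bell_integral (s - (1 + real j) / 2))"
      by (intro prod.cong arg_cong[of _ _ bell_integral]) (simp_all add: field_simps)
    moreover have "card (insert i I) = Suc (card I)" using insert.hyps by simp
    ultimately show ?thesis
      using prod.lessThan_Suc_shift[of "\<lambda>j. bell_integral (s - real j / 2)" "card I"] by simp
  qed
  finally show ?case .
qed

lemma c_const_eq_prod:
  assumes "1 \<le> m"
  shows "c_const m d = (\<Prod>j<d. bell_integral ((m + real d - real j) / 2))"
proof -
  have "c_const m d = enn2real (\<integral>\<^sup>+y. ennreal ((1 + (\<Sum>i<d. (y i)\<^sup>2)) powr (- ((m + real d) / 2)))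
      \<partial>(Pi\<^sub>M {..<d} (\<lambda>_. lborel)))"
    unfolding c_const_def by (rule integral_eq_nn_integral) (auto, measurable)
  also have "\<dots> = (\<Prod>j<d. bell_integral ((m + real d) / 2 - real j / 2))"
    using assms bell_integral_nonneg
    by (subst nn_integral_bell_product) (simp_all add: prod_nonneg)
  finally show ?thesis by (simp add: diff_divide_distrib)
qed

text \<open>Passing from \<open>m = d\<close> to \<open>m = d + 2\<close> raises each of the
  \<open>d\<close> exponents by 1, so \<open>bell_integral_Suc\<close> gives an explicit ratio per
  factor, and these ratios telescope.\<close>

lemma c_const_ratio:
  assumes "1 \<le> d"
  shows "c_const (real d) d = 2 * c_const (real d + 2) d"
proof -
  have step: "bell_integral ((real d + real d - real j) / 2) =
      (2 * real d - real j) / (2 * real d - real j - 1) *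
      bell_integral ((real d + 2 + real d - real j) / 2)" if "j < d" for j
  proof -
    have "1 \<le> (real d + real d - real j) / 2 \<or> d = 1 \<and> j = 0"
      using that by (cases d) auto
    then have ge: "1 \<le> (real d + real d - real j) / 2" by auto
    have e: "(real d + real d - real j) / 2 + 1 = (real d + 2 + real d - real j) / 2"
      by (simp add: field_simps)
    have "2 * real d - real j - 1 > 0" using that by linarith
    then show ?thesis
      using bell_integral_Suc[OF ge] unfolding e by (simp add: field_simps)
  qed
  have tele: "(\<Prod>j<k. (2 * real d - real j) / (2 * real d - real j - 1)) = 2 * real d / (2 * real d - real k)"
    if "k \<le> d" for k
    using that assms
  proof (induction k)
    case (Suc k)
    then have "2 * real d - real k > 0" "2 * real d - real k - 1 > 0" by linarith+
    then show ?case using Suc by (simp add: field_simps)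
  qed auto
  have "c_const (real d) d = (\<Prod>j<d. (2 * real d - real j) / (2 * real d - real j - 1)) *
      c_const (real d + 2) d"
    using assms step by (simp add: c_const_eq_prod prod.distrib[symmetric] del: times_divide_eq_left)
  then show ?thesis using tele[of d] assms by simp
qed

text \<open>Each of the \<open>d\<close> factors has an exponent at most \<open>m\<close>, since
  \<open>d \<le> m\<close>, and is therefore at least \<open>exp (- 1) / sqrt m\<close>.\<close>

lemma c_const_ge:
  assumes "1 \<le> m" "real d \<le> m"
  shows "exp (- real d) * m powr (- real d / 2) \<le> c_const m d"
proof -
  have "exp (- real d) * m powr (- real d / 2) = (\<Prod>j<d. exp (- 1) / sqrt m)"
    using assms by (simp add: power_divide exp_of_nat_mult[symmetric] powr_minus_divide
        powr_half_sqrt[symmetric] powr_power field_simps)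
  also have "\<dots> \<le> c_const m d"
    unfolding c_const_eq_prod[OF assms(1)]
  proof (rule prod_mono, safe)
    fix j assume j: "j < d"
    define s where "s = (m + real d - real j) / 2"
    have s: "1 \<le> s" "s \<le> m" using j assms by (auto simp: s_def)
    have "exp (- 1) / sqrt m \<le> exp (- 1) / sqrt s"
      using s by (intro divide_left_mono) auto
    also have "\<dots> \<le> bell_integral s" by (rule bell_integral_ge[OF s(1)])
    finally show "exp (- 1) / sqrt m \<le> bell_integral s" .
  qed (use assms in auto)
  finally show ?thesis .
qed

text \<open>The outer exponent is 1 here, and the two factors are 2 and
  \<open>2 * d / (4 * d)\<close>.\<close>

lemma beckner_A_Poincare:
  assumes "1 \<le> d"
  shows "beckner_A (real d + 2) d = 1"
proof -
  have "0 < c_const (real d + 2) d"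
    using c_const_ge[of "real d + 2" d] by (smt (verit) exp_gt_zero mult_pos_pos of_nat_0_le_iff powr_gt_zero)
  then show ?thesis
    using assms by (simp add: beckner_A_def c_const_ratio)
qed

subsection \<open>Real inequalities\<close>

text \<open>The shares \<open>x / (x + y)\<close> and \<open>y / (x + y)\<close> add up to 1, and a
  number in the unit interval does not decrease when raised to the power \<open>s\<close>.\<close>

lemma powr_add_le:
  fixes x y :: real
  assumes "0 \<le> x" "0 \<le> y" "0 < s" "s \<le> 1"
  shows "(x + y) powr s \<le> x powr s + y powr s"
proof (cases "x + y = 0")
  case False
  then have pos: "0 < x + y" using assms by simp
  have le: "z * (x + y) powr s / (x + y) \<le> z powr s" if "0 \<le> z" "z \<le> x + y" for z
  proof -
    have "z / (x + y) = (z / (x + y)) powr 1" using that pos by simp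
    also have "\<dots> \<le> (z / (x + y)) powr s"
      using that pos assms by (intro powr_mono') auto
    also have "\<dots> = z powr s / (x + y) powr s"
      using that pos by (simp add: powr_divide)
    finally show ?thesis using pos by (simp add: field_simps)
  qed
  have "(x + y) powr s = x * (x + y) powr s / (x + y) + y * (x + y) powr s / (x + y)"
    using pos by (simp add: add_divide_distrib[symmetric] distrib_right[symmetric])
  also have "\<dots> \<le> x powr s + y powr s"
    using assms by (intro add_mono le) auto
  finally show ?thesis .
qed (use assms in auto)

lemma powr_sum_le:
  fixes x :: "'i \<Rightarrow> real"
  assumes "finite I" "\<And>i. i \<in> I \<Longrightarrow> 0 \<le> x i" "0 < s" "s \<le> 1"
  shows "(\<Sum>i\<in>I. x i) powr s \<le> (\<Sum>i\<in>I. x i powr s)"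
  using assms(1,2)
proof (induction I rule: finite_induct)
  case (insert i I)
  have "(x i + (\<Sum>i\<in>I. x i)) powr s \<le> x i powr s + (\<Sum>i\<in>I. x i) powr s"
    using insert assms by (intro powr_add_le) (auto intro: sum_nonneg)
  then show ?case using insert by force
qed simp

lemma exp_le_quadratic:
  fixes x :: real
  assumes "\<bar>x\<bar> \<le> 1"
  shows "exp x \<le> 1 + x + x\<^sup>2"
proof (cases "0 \<le> x")
  case True
  then show ?thesis using assms exp_bound by auto
next
  case False
  define y where "y = - x"
  have y: "0 < y" using False by (simp add: y_def)
  \<comment> \<open>The product is \<open>1 + y ^ 3\<close>.\<close>
  have "1 \<le> (1 + y) * (1 - y + y\<^sup>2)"
    using y by (simp add: algebra_simps power2_eq_square)
  also have "\<dots> \<le> exp y * (1 - y + y\<^sup>2)"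
  proof (rule mult_right_mono)
    have "1 - y + y\<^sup>2 = (1 - y / 2)\<^sup>2 + 3 / 4 * y\<^sup>2" by (simp add: power2_eq_square field_simps)
    then show "0 \<le> 1 - y + y\<^sup>2" by (metis add_nonneg_nonneg mult_nonneg_nonneg zero_le_power2 zero_le_divide_iff zero_le_numeral)
  qed (rule exp_ge_add_one_self)
  finally have "exp (- y) \<le> 1 - y + y\<^sup>2"
    by (simp add: exp_minus inverse_eq_divide field_simps)
  then show ?thesis by (simp add: y_def)
qed

text \<open>The linear term is kept exactly because it integrates to zero around the mean. For
  \<open>\<bar>u\<bar> \<le> 1 / q\<close> the bound follows from \<open>1 + u \<le> exp u\<close>;
  for larger \<open>u\<close>, \<open>\<bar>1 + u\<bar>\<close> is at most
  \<open>(q + 1) * \<bar>u\<bar>\<close>.\<close>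

lemma powr_one_plus_le:
  fixes q u :: real
  assumes "2 \<le> q"
  shows "\<bar>1 + u\<bar> powr q \<le> 1 + q * u + ((q + 1) powr q + q\<^sup>2) * (u\<^sup>2 + \<bar>u\<bar> powr q)"
proof (cases "\<bar>u\<bar> \<le> 1 / q")
  case True
  then have qu: "\<bar>q * u\<bar> \<le> 1" using assms by (simp add: abs_mult field_simps)
  have "1 / q \<le> 1 / 2" using assms by (simp add: field_simps)
  then have u: "- 1 < u" using True by linarith
  have "\<bar>1 + u\<bar> powr q = exp (q * ln (1 + u))" using u by (simp add: powr_def)
  also have "\<dots> \<le> exp (q * u)"
    using assms u ln_le_minus_one[of "1 + u"] by (simp add: mult_left_mono)
  also have "\<dots> \<le> 1 + q * u + (q * u)\<^sup>2" by (rule exp_le_quadratic[OF qu])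
  also have "(q * u)\<^sup>2 \<le> ((q + 1) powr q + q\<^sup>2) * (u\<^sup>2 + \<bar>u\<bar> powr q)"
    unfolding power_mult_distrib by (intro mult_mono) auto
  finally show ?thesis by simp
next
  case False
  then have u: "1 < q * \<bar>u\<bar>" using assms by (simp add: field_simps)
  have "\<bar>1 + u\<bar> powr q \<le> ((q + 1) * \<bar>u\<bar>) powr q"
    using u assms by (intro powr_mono2) (auto simp: distrib_right)
  also have "\<dots> = (q + 1) powr q * \<bar>u\<bar> powr q" using assms by (simp add: powr_mult)
  finally have 1: "\<bar>1 + u\<bar> powr q \<le> (q + 1) powr q * \<bar>u\<bar> powr q" .
  \<comment> \<open>The affine part may be negative for large \<open>u\<close>; completing the
    square shows that the quadratic term compensates for it.\<close>
  have "1 + q * u + q\<^sup>2 * u\<^sup>2 = (1 + q * u / 2)\<^sup>2 + 3 / 4 * (q * u)\<^sup>2"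
    by (simp add: power2_eq_square field_simps)
  then have 2: "0 \<le> 1 + q * u + q\<^sup>2 * u\<^sup>2"
    by (metis add_nonneg_nonneg mult_nonneg_nonneg zero_le_power2 zero_le_divide_iff zero_le_numeral)
  have 3: "0 \<le> (q + 1) powr q * u\<^sup>2" "0 \<le> q\<^sup>2 * \<bar>u\<bar> powr q" by auto
  have "((q + 1) powr q + q\<^sup>2) * (u\<^sup>2 + \<bar>u\<bar> powr q) =
      (q + 1) powr q * u\<^sup>2 + (q + 1) powr q * \<bar>u\<bar> powr q + q\<^sup>2 * u\<^sup>2 + q\<^sup>2 * \<bar>u\<bar> powr q"
    by (simp add: algebra_simps)
  then show ?thesis using 1 2 3 by linarith
qed

section \<open>Smooth dyadic truncations\<close>

text \<open>A rational replacement for a cut-off at height \<open>a\<close>: small for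
  \<open>\<bar>t\<bar>\<close> far below \<open>a\<close>, close to 1 far above it. The denominator
  never vanishes for \<open>0 < a\<close>, so composition with a smooth function stays
  smooth.\<close>

definition bump_base :: "real \<Rightarrow> real \<Rightarrow> real" where
  "bump_base a t = t\<^sup>2 / (a\<^sup>2 + t\<^sup>2)"

text \<open>The exponent 7 is the least \<open>n\<close> with \<open>4 * (2 / 3 ^ n) powr (1 / 3) \<le> 1 / 2\<close>; this makes the
  recurrence over dyadic levels in the proof of the Sobolev inequality contract, for all \<open>d \<ge> 3\<close> at once.\<close>

definition bump :: "real \<Rightarrow> real \<Rightarrow> real" where
  "bump a t = bump_base a t ^ 7"

lemma bump_denom_pos: "0 < a \<Longrightarrow> 0 < a\<^sup>2 + (t::real)\<^sup>2"
  by (simp add: add_pos_nonneg)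

lemma bump_base_bounds:
  assumes "0 < a"
  shows "0 \<le> bump_base a t" "bump_base a t \<le> 1"
  using bump_denom_pos[OF assms, of t] assms by (auto simp: bump_base_def)

lemma bump_bounds:
  assumes "0 < a"
  shows "0 \<le> bump a t" "bump a t \<le> 1"
  using bump_base_bounds[OF assms, of t] by (auto simp: bump_def power_le_one)

text \<open>Replaces the identity between an indicator and its square. Where
  \<open>2 * t\<^sup>2\<close> is at least \<open>a\<^sup>2\<close>, the bump at level
  \<open>2 * a\<close> is at least \<open>1 / 9 ^ 7\<close> and its square dominates; elsewhere each
  of the seven factors is at most a third of the one at level \<open>a\<close>.\<close>

lemma bump_le_square_plus:
  assumes "0 < a"
  shows "bump (2 * a) t \<le> 9 ^ 7 * (bump (2 * a) t)\<^sup>2 + bump a t / 3 ^ 7"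
proof (cases "(2 * a)\<^sup>2 \<le> 8 * t\<^sup>2")
  case True
  have "1 / 9 \<le> bump_base (2 * a) t"
    using True bump_denom_pos[of "2 * a" t] assms by (simp add: bump_base_def field_simps)
  then have "(1 / 9) ^ 7 \<le> bump (2 * a) t" unfolding bump_def by (intro power_mono) auto
  then have "1 \<le> 9 ^ 7 * bump (2 * a) t" by (simp add: power_divide)
  then have "1 * bump (2 * a) t \<le> (9 ^ 7 * bump (2 * a) t) * bump (2 * a) t"
    using bump_bounds assms by (intro mult_right_mono) auto
  moreover have "0 \<le> bump a t / 3 ^ 7" using bump_bounds assms by simp
  ultimately show ?thesis by (simp add: power2_eq_square)
next
  case False
  have "bump_base (2 * a) t \<le> bump_base a t / 3"
  proof -
    have "t\<^sup>2 / ((2 * a)\<^sup>2 + t\<^sup>2) \<le> t\<^sup>2 / (3 * (a\<^sup>2 + t\<^sup>2))"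
      using False bump_denom_pos[of a t] bump_denom_pos[of "2 * a" t] assms
      by (intro divide_left_mono) (auto simp: power_mult_distrib)
    also have "\<dots> = bump_base a t / 3" by (simp add: bump_base_def mult.commute)
    finally show ?thesis by (simp only: bump_base_def)
  qed
  then have "bump (2 * a) t \<le> (bump_base a t / 3) ^ 7"
    unfolding bump_def using bump_base_bounds assms by (intro power_mono) auto
  also have "\<dots> = bump a t / 3 ^ 7" by (simp add: bump_def power_divide)
  finally show ?thesis by (simp add: add_increasing)
qed

lemma bump_ge:
  assumes "0 < a" "a \<le> \<bar>t\<bar>"
  shows "1 / 2 ^ 7 \<le> bump a t"
proof -
  have "a\<^sup>2 \<le> t\<^sup>2" using assms by (simp add: abs_le_square_iff[symmetric])
  then have "1 / 2 \<le> bump_base a t"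
    using bump_denom_pos[of a t] assms by (simp add: bump_base_def field_simps)
  then have "(1 / 2) ^ 7 \<le> bump a t" unfolding bump_def by (intro power_mono) auto
  then show ?thesis by (simp add: power_divide)
qed

text \<open>The right-hand side telescopes along \<open>a, 2 * a, 4 * a, \<dots>\<close>, which bounds the sum of the energies
  of all dyadic truncations of a function by its own energy.\<close>

lemma bump_base_diff_ge:
  assumes "0 < a"
  shows "3 / 4 * (a\<^sup>2 * t\<^sup>2 / (a\<^sup>2 + t\<^sup>2)\<^sup>2) \<le> bump_base a t - bump_base (2 * a) t"
proof -
  have pos: "0 < a\<^sup>2 + t\<^sup>2" "0 < 4 * a\<^sup>2 + t\<^sup>2"
    using bump_denom_pos[OF assms, of t] bump_denom_pos[of "2 * a" t] assms
    by (auto simp: power_mult_distrib)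
  have "3 / 4 * (a\<^sup>2 * t\<^sup>2 / (a\<^sup>2 + t\<^sup>2)\<^sup>2) = 3 * a\<^sup>2 * t\<^sup>2 / ((a\<^sup>2 + t\<^sup>2) * (4 * (a\<^sup>2 + t\<^sup>2)))"
    by (simp add: power2_eq_square ac_simps)
  also have "\<dots> \<le> 3 * a\<^sup>2 * t\<^sup>2 / ((a\<^sup>2 + t\<^sup>2) * (4 * a\<^sup>2 + t\<^sup>2))"
    using pos by (intro divide_left_mono mult_left_mono mult_pos_pos) auto
  also have "\<dots> = bump_base a t - bump_base (2 * a) t"
    unfolding bump_base_def using pos
    by (subst diff_frac_eq) (auto simp: power_mult_distrib algebra_simps)
  finally show ?thesis .
qed

text \<open>The square of \<open>a * bump_base a t\<close> is \<open>t\<^sup>2\<close> times the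
  expression bounded in \<open>bump_base_diff_ge\<close>; the constant 4/3 from there is rounded up
  to 2.\<close>

lemma bump_square_le:
  assumes "0 < a"
  shows "(a * bump a t)\<^sup>2 \<le> 2 * (bump_base a t - bump_base (2 * a) t) * t\<^sup>2"
proof -
  have "bump a t \<le> bump_base a t"
    unfolding bump_def using bump_base_bounds[OF assms, of t] power_decreasing[of 1 7] by simp
  then have "(a * bump a t)\<^sup>2 \<le> (a * bump_base a t)\<^sup>2"
    using assms bump_bounds[OF assms, of t] by (intro power_mono mult_left_mono) auto
  also have "\<dots> = a\<^sup>2 * t\<^sup>2 / (a\<^sup>2 + t\<^sup>2)\<^sup>2 * t\<^sup>2"
    by (simp add: bump_base_def power_mult_distrib power_divide power2_eq_square)
  also have "\<dots> \<le> 2 * (bump_base a t - bump_base (2 * a) t) * t\<^sup>2"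
  proof -
    have "0 \<le> a\<^sup>2 * t\<^sup>2 / (a\<^sup>2 + t\<^sup>2)\<^sup>2" by simp
    moreover have "z \<le> 2 * y" if "0 \<le> z" "3 / 4 * z \<le> y" for y z :: real using that by linarith
    ultimately have "a\<^sup>2 * t\<^sup>2 / (a\<^sup>2 + t\<^sup>2)\<^sup>2 \<le> 2 * (bump_base a t - bump_base (2 * a) t)"
      using bump_base_diff_ge[OF assms, of t] by blast
    then show ?thesis by (rule mult_right_mono) simp
  qed
  finally show ?thesis .
qed

lemma bump_deriv:
  assumes "0 < a"
  obtains D where "((\<lambda>t. a * bump a t) has_real_derivative D) (at t)"
    "D\<^sup>2 \<le> 300 * (bump_base a t - bump_base (2 * a) t)"
proof
  define r where "r = a\<^sup>2 + t\<^sup>2"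
  have r: "0 < r" using bump_denom_pos[OF assms] by (simp add: r_def)
  let ?b = "bump_base a t"
  let ?D = "a * (7 * ?b ^ 6 * (2 * t * a\<^sup>2 / r\<^sup>2))"
  have "((\<lambda>t. t\<^sup>2 / (a\<^sup>2 + t\<^sup>2)) has_real_derivative (2 * t * a\<^sup>2 / r\<^sup>2)) (at t)"
    using r unfolding r_def
    by (auto intro!: derivative_eq_intros simp: power2_eq_square field_simps)
  from DERIV_cmult[OF DERIV_power[OF this, of 7], of a]
  have "((\<lambda>t. a * (t\<^sup>2 / (a\<^sup>2 + t\<^sup>2)) ^ 7) has_real_derivative ?D) (at t)"
    by (rule DERIV_cong) (simp add: bump_base_def)
  then show "((\<lambda>t. a * bump a t) has_real_derivative ?D) (at t)"
    by (simp add: bump_def bump_base_def)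
  have b: "0 \<le> ?b" "?b \<le> 1" using bump_base_bounds[OF assms] by auto
  have "a\<^sup>2 / r \<le> 1" using r by (simp add: r_def)
  then have ar: "(a\<^sup>2 / r)\<^sup>2 \<le> 1" using r by (simp add: power_le_one)
  \<comment> \<open>Here 196 is the square of 7 * 2. With the factor 4/3 from
    \<open>bump_base_diff_ge\<close> this is below 300.\<close>
  have "?D\<^sup>2 = 196 * (?b ^ 12 * (a\<^sup>2 / r)\<^sup>2) * (a\<^sup>2 * t\<^sup>2 / r\<^sup>2)"
    by (simp add: power_mult_distrib power_divide power2_eq_square field_simps flip: power_add)
  also have "\<dots> \<le> 196 * (1 * 1) * (a\<^sup>2 * t\<^sup>2 / r\<^sup>2)"
    using b ar by (intro mult_right_mono mult_left_mono mult_mono) (auto simp: power_le_one)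
  also have "\<dots> \<le> 300 * (bump_base a t - bump_base (2 * a) t)"
  proof -
    have "0 \<le> a\<^sup>2 * t\<^sup>2 / r\<^sup>2" by simp
    moreover have "196 * (1 * 1) * z \<le> 300 * y" if "0 \<le> z" "3 / 4 * z \<le> y" for y z :: real
      using that by linarith
    ultimately show ?thesis
      using bump_base_diff_ge[OF assms, of t] unfolding r_def[symmetric] by blast
  qed
  finally show "?D\<^sup>2 \<le> 300 * (bump_base a t - bump_base (2 * a) t)" .
qed

lemma sum_le_of_half_recurrence:
  fixes X Y :: "nat \<Rightarrow> real"
  assumes "\<And>k. X (Suc k) \<le> X k / 2 + Y (Suc k)" "\<And>k. 0 \<le> X k" "\<And>k. 0 \<le> Y k"
  shows "(\<Sum>k\<le>n. X k) \<le> 2 * X 0 + 2 * (\<Sum>k\<le>n. Y k)"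
proof -
  \<comment> \<open>The extra \<open>X n\<close> makes the induction close: in the next step it
    absorbs twice the term \<open>X n / 2\<close> of the recurrence.\<close>
  have "(\<Sum>k\<le>n. X k) + X n \<le> 2 * X 0 + 2 * (\<Sum>k\<le>n. Y k)"
  proof (induction n)
    case 0
    then show ?case using assms(3)[of 0] by simp
  next
    case (Suc n)
    then show ?case using assms(1)[of n] by (simp add: algebra_simps)
  qed
  then show ?thesis using assms(2)[of n] by simp
qed

subsection \<open>Nash inequality\<close>

lemma square_powr:
  fixes x :: real
  assumes "0 < x"
  shows "(x\<^sup>2) powr a = x powr (2 * a)"
proof -
  have "x\<^sup>2 = x powr 2" using assms by simp
  then show ?thesis by (simp only: powr_powr)
qed

section \<open>Integrals over the sphere\<close>

lemma integral_sphere_mono: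
  fixes f g :: "'a::euclidean_space \<Rightarrow> real"
  assumes "continuous_on (sphere 0 1) f" "continuous_on (sphere 0 1) g"
    and "\<And>x. x \<in> sphere 0 1 \<Longrightarrow> f x \<le> g x"
  shows "(\<integral>x. f x \<partial>sphere_measure) \<le> (\<integral>x. g x \<partial>sphere_measure)"
  using assms by (intro integral_mono integrable_sphere_measure) auto

lemma integral_sphere_nonneg:
  fixes f :: "'a::euclidean_space \<Rightarrow> real"
  assumes "\<And>x. x \<in> sphere 0 1 \<Longrightarrow> 0 \<le> f x"
  shows "0 \<le> (\<integral>x. f x \<partial>sphere_measure)"
  using assms by (intro integral_nonneg_AE AE_I2) auto

lemma integral_sphere_const:
  "(\<integral>x. c \<partial>(sphere_measure :: 'a::euclidean_space measure)) = (c :: real)"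
proof -
  interpret prob_space "sphere_measure :: 'a measure" by (rule prob_space_sphere_measure)
  show ?thesis using prob_space by simp
qed

lemma sphere_bounded:
  fixes f :: "'a::euclidean_space \<Rightarrow> real"
  assumes "continuous_on (sphere 0 1) f"
  obtains B where "0 < B" "\<And>x. x \<in> sphere 0 1 \<Longrightarrow> \<bar>f x\<bar> \<le> B"
proof -
  have "compact (f ` sphere 0 1)"
    using assms compact_continuous_image compact_sphere by blast
  then obtain B where "\<forall>y\<in>f ` sphere 0 1. norm y \<le> B"
    using compact_imp_bounded bounded_iff by blast
  then have "\<bar>f x\<bar> \<le> max B 1" if "x \<in> sphere 0 1" for x
    using that by (metis image_eqI le_max_iff_disj real_norm_def)
  then show ?thesis using that[of "max B 1"] by auto
qed

text \<open>If \<open>B\<close> bounds \<open>g\<close>, then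
  \<open>(g x)\<^sup>2 \<le> B * g x\<close>. This justifies the divisions by the integral of
  \<open>g\<close> below.\<close>

lemma L1_pos_of_L2_pos:
  fixes g :: "'a::euclidean_space \<Rightarrow> real"
  assumes g: "continuous_on (sphere 0 1) g" "\<And>x. x \<in> sphere 0 1 \<Longrightarrow> 0 \<le> g x"
    and pos: "0 < (\<integral>x. (g x)\<^sup>2 \<partial>sphere_measure)"
  shows "0 < (\<integral>x. g x \<partial>sphere_measure)"
proof -
  obtain B where B: "0 < B" "\<And>x. x \<in> sphere 0 1 \<Longrightarrow> \<bar>g x\<bar> \<le> B"
    using sphere_bounded[OF g(1)] by metis
  have "(\<integral>x. (g x)\<^sup>2 \<partial>sphere_measure) \<le> (\<integral>x. B * g x \<partial>sphere_measure)"
  proof (rule integral_sphere_mono)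
    fix x :: 'a assume x: "x \<in> sphere 0 1"
    show "(g x)\<^sup>2 \<le> B * g x"
      unfolding power2_eq_square using B(2)[OF x] g(2)[OF x] by (intro mult_right_mono) auto
  qed (use g in \<open>auto intro!: continuous_intros\<close>)
  then have "0 < B * (\<integral>x. g x \<partial>sphere_measure)" using pos by simp
  then show ?thesis using B(1) by (simp add: zero_less_mult_iff)
qed

text \<open>Hoelder interpolation, proved by applying Young's inequality pointwise to the normalised
  functions \<open>g / W\<close> and \<open>g\<^sup>2 / V\<close>, each of integral 1.\<close>

lemma Lp_interpolation:
  fixes g :: "'a::euclidean_space \<Rightarrow> real"
  assumes g: "continuous_on (sphere 0 1) g" "\<And>x. x \<in> sphere 0 1 \<Longrightarrow> 0 \<le> g x"
    and p: "1 \<le> p" "p \<le> 2"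
    and V: "V = (\<integral>x. (g x)\<^sup>2 \<partial>sphere_measure)" "0 < V"
    and W: "W = (\<integral>x. g x \<partial>sphere_measure)"
  shows "(\<integral>x. g x powr (2 / p) \<partial>sphere_measure) powr p \<le> V * (W\<^sup>2 / V) powr (p - 1)"
proof -
  have W0: "0 < W" unfolding W by (rule L1_pos_of_L2_pos[OF g V(2)[unfolded V(1)]])
  \<comment> \<open>The weights with \<open>a + b = 1\<close> that write the exponent
    \<open>2 / p\<close> as \<open>a * 1 + b * 2\<close>.\<close>
  define a b where "a = 2 - 2 / p" and "b = 2 / p - 1"
  have ab: "0 \<le> a" "0 \<le> b" "a + b = 1" "a + 2 * b = 2 / p"
    using p by (auto simp: a_def b_def field_simps)
  have int: "integrable sphere_measure (\<lambda>x. (W powr a * V powr b) * (a * (g x / W) + b * ((g x)\<^sup>2 / V)))"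
    using g by (intro integrable_sphere_measure continuous_intros) (use W0 V in auto)
  have i1: "integrable sphere_measure g" and i2: "integrable sphere_measure (\<lambda>x. (g x)\<^sup>2)"
    using g by (auto intro!: integrable_sphere_measure continuous_intros)
  have "(\<integral>x. g x powr (2 / p) \<partial>sphere_measure) \<le>
      (\<integral>x. (W powr a * V powr b) * (a * (g x / W) + b * ((g x)\<^sup>2 / V)) \<partial>sphere_measure)"
  proof (rule integral_mono'[OF int])
    fix x :: 'a assume "x \<in> space sphere_measure"
    then have gx: "0 \<le> g x" using g by simp
    show "0 \<le> (W powr a * V powr b) * (a * (g x / W) + b * ((g x)\<^sup>2 / V))"
      using gx ab W0 V by (intro mult_nonneg_nonneg add_nonneg_nonneg divide_nonneg_pos) auto
    show "g x powr (2 / p) \<le> (W powr a * V powr b) * (a * (g x / W) + b * ((g x)\<^sup>2 / V))"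
    proof (cases "g x = 0")
      case False
      then have pos: "0 < g x" using gx by simp
      have sq: "((g x)\<^sup>2) powr b = g x powr (2 * b)"
        by (rule square_powr[OF pos])
      have "g x powr (2 / p) = g x powr a * ((g x)\<^sup>2) powr b"
        unfolding sq ab(4)[symmetric] by (rule powr_add)
      also have "\<dots> = (W powr a * V powr b) * ((g x / W) powr a * ((g x)\<^sup>2 / V) powr b)"
        using pos W0 V by (simp add: powr_divide)
      also have "\<dots> \<le> (W powr a * V powr b) * (a * (g x / W) + b * ((g x)\<^sup>2 / V))"
        using pos W0 V ab by (intro mult_left_mono Youngs_inequality_0) auto
      finally show ?thesis .
    qed (use p in auto)
  qed
  also have "\<dots> = W powr a * V powr b"
    using W0 V(2) ab(3) i1 i2 by (simp add: W[symmetric] V(1)[symmetric])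
  finally have "(\<integral>x. g x powr (2 / p) \<partial>sphere_measure) powr p \<le> (W powr a * V powr b) powr p"
    using p by (intro powr_mono2 integral_sphere_nonneg) auto
  also have "\<dots> = W powr (2 * (p - 1)) * V powr (2 - p)"
    using p by (simp add: powr_mult powr_powr a_def b_def algebra_simps)
  also have "\<dots> = V * (W\<^sup>2 / V) powr (p - 1)"
  proof -
    have "(W\<^sup>2) powr (p - 1) = W powr (2 * (p - 1))" by (rule square_powr[OF W0])
    moreover have "V powr (2 - p) = V / V powr (p - 1)"
      using V(2) powr_diff[of V 1 "p - 1"] by simp
    ultimately show ?thesis using W0 V(2) by (simp add: powr_divide)
  qed
  finally show ?thesis .
qed

text \<open>Since \<open>p - 1\<close> is also the exponent in A, the two powers merge into one
  power of \<open>c(d,d) / c(m,d) * R\<close>. By \<open>c_const_ge\<close> the condition on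
  \<open>R\<close> makes this base at most 1.\<close>

lemma beckner_A_mult_powr_le:
  assumes d: "1 \<le> d" and m: "real d < m"
    and R: "0 \<le> R" "c_const (real d) d * exp (real d) * m powr (real d / 2) * R \<le> 1"
  shows "beckner_A m d * R powr (beckner_p m d - 1) \<le> (m + real d - 2) / (m + 3 * real d - 2)"
proof -
  let ?\<theta> = "2 / (m - real d)"
  have c: "exp (- real d) * m powr (- real d / 2) \<le> c_const m d"
    using d m by (intro c_const_ge) auto
  have pos: "0 < exp (- real d) * m powr (- real d / 2)" using m by simp
  have c0: "0 \<le> c_const (real d) d" using c_const_ge[of "real d" d] d
    by (smt (verit) exp_gt_zero mult_nonneg_nonneg of_nat_1 of_nat_le_iff powr_ge_zero)
  have "c_const (real d) d / c_const m d * R \<le>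
      c_const (real d) d / (exp (- real d) * m powr (- real d / 2)) * R"
    using c pos c0 R by (intro mult_right_mono divide_left_mono mult_pos_pos) auto
  also have "\<dots> = c_const (real d) d * exp (real d) * m powr (real d / 2) * R"
    by (simp add: exp_minus powr_minus field_simps)
  finally have le: "c_const (real d) d / c_const m d * R \<le> 1" using R by simp
  have cm: "0 < c_const m d" using c pos by linarith
  have "beckner_A m d * R powr (beckner_p m d - 1) =
      (c_const (real d) d / c_const m d * R) powr ?\<theta> * ((m + real d - 2) / (m + 3 * real d - 2))"
    using c0 cm R by (subst powr_mult) (auto simp: beckner_A_def beckner_p_def)
  also have "\<dots> \<le> 1 * ((m + real d - 2) / (m + 3 * real d - 2))"
    using le c0 cm R d m by (intro mult_right_mono powr_le1 divide_nonneg_pos mult_nonneg_nonneg) auto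
  finally show ?thesis by simp
qed

lemma Nash_inequality:
  fixes d :: nat
  assumes d: "2 \<le> d"
    and beckner: "\<And>(m::real) (f :: 'a::euclidean_space \<Rightarrow> real).
      m \<ge> real d + 2 \<Longrightarrow> smooth_on_sphere f \<Longrightarrow> (\<forall>x\<in>sphere 0 1. 0 \<le> f x) \<Longrightarrow>
      (\<integral>x. (f x)\<^sup>2 \<partial>sphere_measure) \<le>
        beckner_A m d * (\<integral>x. f x powr (2 / beckner_p m d) \<partial>sphere_measure) powr beckner_p m d
        + 16 / ((m + 2 - real d) * (3 * real d - 2 + m)) * (\<integral>x. carre_du_champ f x \<partial>sphere_measure)"
  obtains C where "0 < C" "\<And>g :: 'a \<Rightarrow> real. smooth_on_sphere g \<Longrightarrow> (\<forall>x\<in>sphere 0 1. 0 \<le> g x) \<Longrightarrow>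
    (\<integral>x. (g x)\<^sup>2 \<partial>sphere_measure) \<le>
      C * ((\<integral>x. g x \<partial>sphere_measure)\<^sup>2 / (\<integral>x. (g x)\<^sup>2 \<partial>sphere_measure)) powr (2 / real d) *
      ((\<integral>x. (g x)\<^sup>2 \<partial>sphere_measure) + (\<integral>x. carre_du_champ g x \<partial>sphere_measure))"
proof -
  define K where "K = c_const (real d) d * exp (real d)"
  have K: "0 < K"
    using c_const_ge[of "real d" d] d unfolding K_def
    by (smt (verit) exp_gt_zero mult_pos_pos of_nat_0_less_iff of_nat_1 of_nat_le_iff powr_gt_zero
        less_le_trans zero_less_numeral one_le_numeral order_trans)
  \<comment> \<open>Chosen so that \<open>8 * (d + 2) / m\<close> becomes
    \<open>C * R powr (2 / d)\<close> for the \<open>m\<close> selected below.\<close>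
  define C where "C = 8 * (real d + 2) * K powr (2 / real d)"
  have C: "0 < C" using K d by (simp add: C_def)
  have main: "V \<le> C * (W\<^sup>2 / V) powr (2 / real d) * (V + E)"
    if g: "smooth_on_sphere g" "\<forall>x\<in>sphere 0 1. 0 \<le> g x"
      and V: "V = (\<integral>x. (g x)\<^sup>2 \<partial>sphere_measure)" "0 < V"
      and W: "W = (\<integral>x. g x \<partial>sphere_measure)"
      and E: "E = (\<integral>x. carre_du_champ g x \<partial>sphere_measure)"
    for g :: "'a \<Rightarrow> real" and V W E
  proof -
    have cont: "continuous_on (sphere 0 1) g" using g smooth_on_sphere_imp_continuous by blast
    have E0: "0 \<le> E" unfolding E by (intro integral_sphere_nonneg carre_du_champ_nonneg)
    have W0: "0 < W" unfolding W
      by (rule L1_pos_of_L2_pos[OF cont _ V(2)[unfolded V(1)]]) (use g(2) in blast)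
    define R where "R = W\<^sup>2 / V"
    have R: "0 < R" using W0 V by (simp add: R_def)
    \<comment> \<open>With this \<open>m\<close> the bound \<open>A * R powr (p - 1) \<le> (m + d - 2) / (m + 3 * d - 2)\<close> leaves a gap
      \<open>2 * d / (m + 3 * d - 2)\<close> of the same order as the factor in front of the energy times \<open>m\<close>.\<close>
    define m where "m = (K * R) powr (- (2 / real d))"
    have m0: "0 < m" using K R by (simp add: m_def)
    have inv_m: "1 / m = (K * R) powr (2 / real d)"
      using K R by (simp add: m_def powr_minus_divide)
    have CR: "8 * (real d + 2) / m = C * R powr (2 / real d)"
      using inv_m K R by (simp add: C_def powr_mult divide_inverse)
    have "V \<le> 8 * (real d + 2) / m * (V + E)"
    proof (cases "real d + 2 \<le> m")
      case True
      have "m powr (real d / 2) = (K * R) powr (- 1)"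
        using K R d by (simp add: m_def powr_powr)
      \<comment> \<open>The condition of \<open>beckner_A_mult_powr_le\<close> thus holds with
        equality.\<close>
      then have KR: "K * m powr (real d / 2) * R = 1"
        using K R by (simp add: powr_minus field_simps)
      let ?p = "beckner_p m d"
      have p: "1 \<le> ?p" "?p \<le> 2" using True by (auto simp: beckner_p_def field_simps)
      let ?\<rho> = "(m + real d - 2) / (m + 3 * real d - 2)"
      have A0: "0 \<le> beckner_A m d"
        using True d by (simp add: beckner_A_def)
      have "V \<le> beckner_A m d * (\<integral>x. g x powr (2 / ?p) \<partial>sphere_measure) powr ?p
          + 16 / ((m + 2 - real d) * (3 * real d - 2 + m)) * E"
        unfolding V E by (rule beckner[OF True g])
      also have "\<dots> \<le> beckner_A m d * (V * R powr (?p - 1))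
          + 16 / ((m + 2 - real d) * (3 * real d - 2 + m)) * E"
        using Lp_interpolation[OF cont _ p V W] g A0 unfolding R_def
        by (intro add_right_mono mult_left_mono) auto
      also have "beckner_A m d * (V * R powr (?p - 1)) \<le> ?\<rho> * V"
      proof -
        have "beckner_A m d * R powr (?p - 1) \<le> ?\<rho>"
          using True d R KR by (intro beckner_A_mult_powr_le) (auto simp: K_def)
        then have "beckner_A m d * R powr (?p - 1) * V \<le> ?\<rho> * V"
          using V(2) by (intro mult_right_mono) auto
        then show ?thesis by (simp only: ac_simps)
      qed
      finally have le: "V \<le> ?\<rho> * V + 16 / ((m + 2 - real d) * (3 * real d - 2 + m)) * E" by simp
      have pos: "0 < 3 * real d - 2 + m" "0 < m + 2 - real d" using True d by auto
      \<comment> \<open>After clearing the denominator \<open>m + 3 * d - 2\<close>, the two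
        coefficients of \<open>V\<close> differ by exactly \<open>2 * d\<close>.\<close>
      have "(3 * real d - 2 + m) * V \<le>
          (3 * real d - 2 + m) * (?\<rho> * V + 16 / ((m + 2 - real d) * (3 * real d - 2 + m)) * E)"
        using le pos by (intro mult_left_mono) auto
      also have "\<dots> = (m + real d - 2) * V + 16 / (m + 2 - real d) * E"
      proof -
        have "P * (N / P * v + 16 / (Q * P) * e) = N * v + 16 / Q * e"
          if "0 < P" "0 < Q" for P Q N v e :: real
          using that by (simp add: field_simps)
        then show ?thesis using pos by (simp add: add.commute add_diff_eq)
      qed
      finally have "2 * real d * V \<le> 16 / (m + 2 - real d) * E" by (simp add: algebra_simps)
      moreover have "1 * V \<le> real d * V" using d V by (intro mult_right_mono) auto
      ultimately have "V \<le> 8 / (m + 2 - real d) * E" by linarith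
      also have "\<dots> \<le> 8 * (real d + 2) / m * E"
      proof (rule mult_right_mono[OF _ E0])
        \<comment> \<open>Trades \<open>m + 2 - d\<close> for \<open>m\<close> at the cost of a
          factor \<open>d + 2\<close>.\<close>
        have "m * 1 \<le> (real d + 2) * (m + 2 - real d)"
        proof -
          have "(real d + 1) * (real d + 2) \<le> (real d + 1) * m" using True by (intro mult_left_mono) auto
          then show ?thesis by (simp add: algebra_simps)
        qed
        then show "8 / (m + 2 - real d) \<le> 8 * (real d + 2) / m"
          using pos m0 by (simp add: field_simps)
      qed
      also have "\<dots> \<le> 8 * (real d + 2) / m * (V + E)"
        using V m0 by (intro mult_left_mono) auto
      finally show ?thesis .
    next
      case False
      \<comment> \<open>The desired \<open>m\<close> is outside the range of the hypothesis. The
        factor in front then exceeds 1, and the summand \<open>V\<close> on the right already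
        suffices.\<close>
      then have "1 \<le> 8 * (real d + 2) / m" using m0 by (simp add: field_simps)
      then have "1 * V \<le> 8 * (real d + 2) / m * (V + E)"
        using V E0 by (intro mult_mono) auto
      then show ?thesis by simp
    qed
    then show ?thesis unfolding CR R_def .
  qed
  show ?thesis
  proof (rule that[OF C])
    fix g :: "'a \<Rightarrow> real" assume g: "smooth_on_sphere g" "\<forall>x\<in>sphere 0 1. 0 \<le> g x"
    let ?V = "\<integral>x. (g x)\<^sup>2 \<partial>sphere_measure"
    have "0 \<le> ?V" by simp
    then consider "?V = 0" | "0 < ?V" by linarith
    then show "?V \<le> C * ((\<integral>x. g x \<partial>sphere_measure)\<^sup>2 / ?V) powr (2 / real d) *
        (?V + (\<integral>x. carre_du_champ g x \<partial>sphere_measure))"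
      \<comment> \<open>If \<open>V = 0\<close>, then division by zero gives 0 and
        \<open>0 powr _\<close> is 0, so both sides vanish.\<close>
      by cases (simp, use main[OF g refl _ refl refl] in blast)
  qed
qed

subsection \<open>Sobolev inequality by dyadic truncation\<close>

lemma smooth_bump:
  assumes "smooth_on_sphere f" "0 < a"
  shows "smooth_on_sphere (\<lambda>x. a * bump a (f x))"
proof -
  have "smooth_on_sphere (\<lambda>x. a * ((f x)\<^sup>2 * inverse (a\<^sup>2 + (f x)\<^sup>2)) ^ 7)"
    using assms bump_denom_pos[OF assms(2), THEN less_imp_neq, symmetric]
    by (intro smooth_on_sphere_mult smooth_on_sphere_const smooth_on_sphere_power
        smooth_on_sphere_inverse smooth_on_sphere_add) auto
  then show ?thesis by (simp add: bump_def bump_base_def divide_inverse)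
qed

lemma bump_energy_le:
  assumes "smooth_on_sphere f" "0 < a" "x \<in> sphere 0 1"
  shows "(a * bump a (f x))\<^sup>2 + carre_du_champ (\<lambda>y. a * bump a (f y)) x \<le>
    300 * (bump_base a (f x) - bump_base (2 * a) (f x)) * ((f x)\<^sup>2 + carre_du_champ f x)"
proof -
  obtain D where D: "((\<lambda>t. a * bump a t) has_real_derivative D) (at (f x))"
    "D\<^sup>2 \<le> 300 * (bump_base a (f x) - bump_base (2 * a) (f x))"
    using bump_deriv[OF assms(2)] by metis
  let ?h = "bump_base a (f x) - bump_base (2 * a) (f x)"
  have h: "0 \<le> 300 * ?h" using D(2) order_trans[OF zero_le_power2] by blast
  have "(a * bump a (f x))\<^sup>2 \<le> 2 * ?h * (f x)\<^sup>2" by (rule bump_square_le[OF assms(2)])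
  also have "\<dots> \<le> 300 * ?h * (f x)\<^sup>2" using h by (intro mult_right_mono) auto
  finally have "(a * bump a (f x))\<^sup>2 \<le> 300 * ?h * (f x)\<^sup>2" .
  moreover have "carre_du_champ (\<lambda>y. a * bump a (f y)) x \<le> 300 * ?h * carre_du_champ f x"
    unfolding carre_du_champ_chain[OF assms(1,3) D(1)]
    using D(2) by (intro mult_right_mono carre_du_champ_nonneg)
  ultimately show ?thesis by (simp only: distrib_left)
qed


text \<open>By \<open>bump_energy_le\<close> each level costs a difference of consecutive values of
  \<open>bump_base\<close>, and these telescope to at most 1. The bound depends neither on
  \<open>n\<close> nor on \<open>a\<close>.\<close>

lemma bump_energy_sum_le:
  assumes "smooth_on_sphere f" "0 < a" "x \<in> sphere 0 1"
  shows "(\<Sum>k\<le>n. (2 ^ k * a * bump (2 ^ k * a) (f x))\<^sup>2 +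
      carre_du_champ (\<lambda>y. 2 ^ k * a * bump (2 ^ k * a) (f y)) x) \<le>
    300 * ((f x)\<^sup>2 + carre_du_champ f x)"
proof -
  let ?h = "\<lambda>k. bump_base (2 ^ k * a) (f x)"
  let ?e = "(f x)\<^sup>2 + carre_du_champ f x"
  have e: "0 \<le> ?e" using carre_du_champ_nonneg[of f x] by simp
  have "(\<Sum>k\<le>n. (2 ^ k * a * bump (2 ^ k * a) (f x))\<^sup>2 +
      carre_du_champ (\<lambda>y. 2 ^ k * a * bump (2 ^ k * a) (f y)) x) \<le>
      (\<Sum>k\<le>n. 300 * (?h k - ?h (Suc k)) * ?e)"
  proof (rule sum_mono)
    fix k
    show "(2 ^ k * a * bump (2 ^ k * a) (f x))\<^sup>2 +
        carre_du_champ (\<lambda>y. 2 ^ k * a * bump (2 ^ k * a) (f y)) x \<le> 300 * (?h k - ?h (Suc k)) * ?e"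
      using bump_energy_le[OF assms(1) _ assms(3), of "2 ^ k * a"] assms(2)
      by (simp only: power_Suc mult.assoc) simp
  qed
  also have "\<dots> = 300 * (\<Sum>k\<le>n. ?h k - ?h (Suc k)) * ?e"
    by (simp only: sum_distrib_left sum_distrib_right)
  also have "(\<Sum>k\<le>n. ?h k - ?h (Suc k)) = ?h 0 - ?h (Suc n)"
    by (rule sum_telescope)
  also have "300 * (?h 0 - ?h (Suc n)) * ?e \<le> 300 * 1 * ?e"
  proof (intro mult_right_mono[OF _ e] mult_left_mono)
    have "0 \<le> ?h (Suc n)" "?h 0 \<le> 1"
      using assms(2) by (auto intro!: bump_base_bounds)
    then show "?h 0 - ?h (Suc n) \<le> 1" by linarith
  qed simp
  finally show ?thesis by simp
qed

text \<open>Unless \<open>\<bar>t\<bar> < a\<close>, it lies between \<open>2 ^ k * a\<close> and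
  twice that for some \<open>k \<le> n\<close>. The bump at this level is at least
  \<open>1 / 2 ^ 7\<close>, so the single summand \<open>k\<close> already suffices.\<close>

lemma powr_le_bump_sum:
  fixes a q t :: real
  assumes a: "0 < a" and q: "0 < q" and t: "\<bar>t\<bar> < 2 ^ Suc n * a"
  shows "\<bar>t\<bar> powr q \<le> a powr q + 2 powr q * 2 ^ 7 * (\<Sum>k\<le>n. (2 ^ k * a) powr q * bump (2 ^ k * a) t)"
proof (cases "\<bar>t\<bar> < a")
  case True
  then have "\<bar>t\<bar> powr q \<le> a powr q" using q by (intro powr_mono2) auto
  moreover have "0 \<le> (\<Sum>k\<le>n. (2 ^ k * a) powr q * bump (2 ^ k * a) t)"
    using a by (intro sum_nonneg mult_nonneg_nonneg bump_bounds) auto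
  ultimately show ?thesis by (simp add: add_increasing2)
next
  case False
  define k where "k = (LEAST k. \<bar>t\<bar> < 2 ^ Suc k * a)"
  have k: "\<bar>t\<bar> < 2 ^ Suc k * a" unfolding k_def by (rule LeastI[of _ n]) (rule t)
  have kn: "k \<le> n" unfolding k_def by (rule Least_le) (rule t)
  have ge: "2 ^ k * a \<le> \<bar>t\<bar>"
  proof (cases k)
    case 0
    then show ?thesis using False by simp
  next
    case (Suc j)
    then show ?thesis using not_less_Least[of j "\<lambda>k. \<bar>t\<bar> < 2 ^ Suc k * a"] by (simp add: k_def)
  qed
  have "\<bar>t\<bar> powr q \<le> (2 * (2 ^ k * a)) powr q" using k q by (intro powr_mono2) auto
  also have "\<dots> = 2 powr q * 2 ^ 7 * ((2 ^ k * a) powr q * (1 / 2 ^ 7))" using a by (simp add: powr_mult)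
  also have "\<dots> \<le> 2 powr q * 2 ^ 7 * ((2 ^ k * a) powr q * bump (2 ^ k * a) t)"
    using bump_ge[OF _ ge] a by (intro mult_left_mono) auto
  also have "\<dots> \<le> 2 powr q * 2 ^ 7 * (\<Sum>k\<le>n. (2 ^ k * a) powr q * bump (2 ^ k * a) t)"
    using a kn by (intro mult_left_mono member_le_sum[of k "{..n}"]) (auto intro!: mult_nonneg_nonneg bump_bounds)
  also have "\<dots> \<le> a powr q + \<dots>" by simp
  finally show ?thesis .
qed

lemma continuous_on_bump: "0 < a \<Longrightarrow> continuous_on UNIV (bump a)"
  unfolding bump_def[abs_def] bump_base_def[abs_def]
  by (intro continuous_intros) (metis bump_denom_pos less_irrefl)

lemma continuous_on_bump_compose:
  "continuous_on S f \<Longrightarrow> 0 < a \<Longrightarrow> continuous_on S (\<lambda>x. bump a (f x))"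
  using continuous_on_compose2[OF continuous_on_bump, of a S f] by auto

text \<open>The integrals \<open>w k\<close> of the bumps act as a distribution function of
  \<open>\<bar>f\<bar>\<close> at the levels \<open>2 ^ k * a\<close>. At each level either the Nash
  inequality for the truncation bounds \<open>X k\<close> by its energy, or \<open>w\<close> has
  dropped so much that \<open>X\<close> halves. Summing over the levels and letting \<open>a\<close>
  tend to 0 gives the claim.\<close>

lemma Sobolev_inequality_nontight:
  fixes d :: nat
  assumes d: "3 \<le> d" and C: "0 < C"
    and nash: "\<And>g :: 'a::euclidean_space \<Rightarrow> real. smooth_on_sphere g \<Longrightarrow> (\<forall>x\<in>sphere 0 1. 0 \<le> g x) \<Longrightarrow>
    (\<integral>x. (g x)\<^sup>2 \<partial>sphere_measure) \<le>
      C * ((\<integral>x. g x \<partial>sphere_measure)\<^sup>2 / (\<integral>x. (g x)\<^sup>2 \<partial>sphere_measure)) powr (2 / real d) *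
      ((\<integral>x. (g x)\<^sup>2 \<partial>sphere_measure) + (\<integral>x. carre_du_champ g x \<partial>sphere_measure))"
  obtains B where "0 < B" "\<And>f :: 'a \<Rightarrow> real. smooth_on_sphere f \<Longrightarrow>
    (\<integral>x. \<bar>f x\<bar> powr (2 * real d / (real d - 2)) \<partial>sphere_measure) powr ((real d - 2) / real d) \<le>
      B * ((\<integral>x. (f x)\<^sup>2 \<partial>sphere_measure) + (\<integral>x. carre_du_champ f x \<partial>sphere_measure))"
proof -
  define q s where "q = 2 * real d / (real d - 2)" and "s = (real d - 2) / real d"
  have s: "1 / 3 \<le> s" "s < 1" "0 < s" using d by (auto simp: s_def field_simps)
  have q: "0 < q" "q * s = 2" using d by (auto simp: q_def s_def field_simps)
  have sd: "s = 1 - 2 / real d" using d by (simp add: s_def field_simps)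
  \<comment> \<open>If \<open>w (Suc k) > Q * v (Suc k)\<close>, then the square term in
    \<open>wv\<close> is below half of \<open>w (Suc k)\<close> and can be absorbed on the
    left.\<close>
  define Q :: real where "Q = 2 * 9 ^ 7"
  have Q: "0 < Q" by (simp add: Q_def)
  define C' where "C' = C * Q * Q powr (2 / real d)"
  have C': "0 < C'" using C Q by (simp add: C'_def)
  define D where "D = 2 powr q * (2 ^ 7 :: real)"
  have D: "0 < D" by (simp add: D_def)
  define B where "B = D powr s * (2 * C' * 300)"
  have B: "0 < B" using D C' by (simp add: B_def)
  \<comment> \<open>Uses \<open>s \<ge> 1 / 3\<close>, that is \<open>d \<ge> 3\<close>, and
    \<open>2 / 3 ^ 7 < 1 / 512\<close>. The factor 1/8 leaves 1/2 after the factor 4 from doubling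
    the level.\<close>
  have ratio: "(2 / 3 ^ 7 :: real) powr s \<le> 1 / 8"
  proof -
    have "(2 / 3 ^ 7 :: real) powr s \<le> (2 / 3 ^ 7) powr (1 / 3)"
      using s by (intro powr_mono') auto
    also have "\<dots> \<le> ((1 / 8) ^ 3) powr (1 / 3)" by (intro powr_mono2) (auto simp: power_divide)
    also have "\<dots> = 1 / 8" by (simp add: powr_powr flip: powr_numeral)
    finally show ?thesis .
  qed
  have main: "(\<integral>x. \<bar>f x\<bar> powr q \<partial>sphere_measure) powr s \<le>
      (1 + 2 * D powr s) * a\<^sup>2 + B * ((\<integral>x. (f x)\<^sup>2 \<partial>sphere_measure) + (\<integral>x. carre_du_champ f x \<partial>sphere_measure))"
    if f: "smooth_on_sphere f" and a: "0 < a" for f :: "'a \<Rightarrow> real" and a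
  proof -
    have cf: "continuous_on (sphere 0 1) f" by (rule smooth_on_sphere_imp_continuous[OF f])
    define l where "l k = 2 ^ k * a" for k :: nat
    have l: "0 < l k" "l (Suc k) = 2 * l k" for k using a by (auto simp: l_def)
    define g where "g k x = l k * bump (l k) (f x)" for k x
    have g: "smooth_on_sphere (g k)" "\<forall>x\<in>sphere 0 1. 0 \<le> g k x" for k
      using smooth_bump[OF f l(1)] l(1)[of k] bump_bounds(1)[OF l(1)]
      by (auto simp: g_def[abs_def] less_imp_le)
    have cb: "continuous_on (sphere 0 1) (\<lambda>x. bump (l k) (f x))" for k
      by (rule continuous_on_bump_compose[OF cf l(1)])
    define w v F where "w k = (\<integral>x. bump (l k) (f x) \<partial>sphere_measure)"
      and "v k = (\<integral>x. (bump (l k) (f x))\<^sup>2 \<partial>sphere_measure)"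
      and "F k = (\<integral>x. (g k x)\<^sup>2 \<partial>sphere_measure) + (\<integral>x. carre_du_champ (g k) x \<partial>sphere_measure)" for k
    have w0: "0 \<le> w k" and v0: "0 \<le> v k" and F0: "0 \<le> F k" for k
      unfolding w_def v_def F_def using l(1) carre_du_champ_nonneg
      by (auto intro!: integral_sphere_nonneg bump_bounds add_nonneg_nonneg)
    have ib: "integrable sphere_measure (\<lambda>x. bump (l k) (f x))"
      "integrable sphere_measure (\<lambda>x. (bump (l k) (f x))\<^sup>2)" for k
      using cb by (auto intro!: integrable_sphere_measure continuous_intros)
    have w1: "w k \<le> 1" for k
    proof -
      have "w k \<le> (\<integral>x. 1 \<partial>(sphere_measure :: 'a measure))"
        unfolding w_def using cb l(1) by (intro integral_sphere_mono) (auto intro!: bump_bounds)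
      then show ?thesis by (simp only: integral_sphere_const)
    qed
    have wv: "w (Suc k) \<le> 9 ^ 7 * v (Suc k) + w k / 3 ^ 7" for k
    proof -
      have "w (Suc k) \<le> (\<integral>x. 9 ^ 7 * (bump (l (Suc k)) (f x))\<^sup>2 + bump (l k) (f x) / 3 ^ 7 \<partial>sphere_measure)"
        unfolding w_def using bump_le_square_plus[OF l(1)[of k]] cb[of k] cb[of "Suc k"]
        by (intro integral_sphere_mono continuous_intros) (auto simp: l(2))
      also have "\<dots> = 9 ^ 7 * v (Suc k) + w k / 3 ^ 7"
        unfolding w_def v_def using ib by simp
      finally show ?thesis .
    qed
    have gV: "(\<integral>x. (g k x)\<^sup>2 \<partial>sphere_measure) = (l k)\<^sup>2 * v k" and gW: "(\<integral>x. g k x \<partial>sphere_measure) = l k * w k" for k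
      by (simp_all add: g_def v_def w_def power_mult_distrib)
    define X where "X k = (l k)\<^sup>2 * w k powr s" for k
    have X0: "0 \<le> X k" for k by (simp add: X_def)
    \<comment> \<open>In the Nash quotient the level \<open>l k\<close> cancels, leaving
      \<open>w\<^sup>2 / v \<le> Q * w\<close>. Dividing by \<open>w powr (2 / d)\<close> leaves the
      power \<open>s\<close> of \<open>w\<close>.\<close>
    have good: "X k \<le> C' * F k" if "w k \<le> Q * v k" for k
    proof (cases "w k = 0")
      case False
      then have w: "0 < w k" using w0[of k] by simp
      then have v: "0 < v k" using that Q by (metis less_le_trans zero_less_mult_pos)
      have lk: "0 < (l k)\<^sup>2" using l(1)[of k] by simp
      have "(l k * w k)\<^sup>2 / ((l k)\<^sup>2 * v k) = w k * (w k / v k)"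
        using l(1)[of k] by (simp add: power_mult_distrib power2_eq_square)
      also have "\<dots> \<le> w k * Q" using that w v by (intro mult_left_mono) (auto simp: field_simps)
      finally have R: "(l k * w k)\<^sup>2 / ((l k)\<^sup>2 * v k) \<le> Q * w k" by (simp add: mult.commute)
      have "(l k)\<^sup>2 * w k \<le> Q * ((l k)\<^sup>2 * v k)"
        using that lk by (simp add: mult.left_commute mult_left_mono)
      also have "(l k)\<^sup>2 * v k \<le> C * ((l k * w k)\<^sup>2 / ((l k)\<^sup>2 * v k)) powr (2 / real d) * F k"
        using nash[OF g, of k] unfolding gV gW F_def .
      also have "\<dots> \<le> C * (Q * w k) powr (2 / real d) * F k"
        using R C F0 v lk by (intro mult_right_mono mult_left_mono powr_mono2) auto
      also have "(Q * w k) powr (2 / real d) = Q powr (2 / real d) * w k powr (2 / real d)"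
        using Q w by (simp add: powr_mult)
      finally have "(l k)\<^sup>2 * w k \<le> C' * F k * w k powr (2 / real d)"
        using Q by (simp add: C'_def ac_simps)
      moreover have "w k = w k powr s * w k powr (2 / real d)"
        using w by (simp add: sd powr_add[symmetric])
      ultimately have "X k * w k powr (2 / real d) \<le> C' * F k * w k powr (2 / real d)"
        by (simp add: X_def mult.assoc)
      then show ?thesis using w by simp
    qed (use C' F0 in \<open>simp add: X_def\<close>)
    have step: "X (Suc k) \<le> X k / 2 + C' * F (Suc k)" for k
    proof (cases "w (Suc k) \<le> Q * v (Suc k)")
      case True
      then show ?thesis using good[OF True] X0[of k] by linarith
    next
      case False
      then have "w (Suc k) \<le> 2 / 3 ^ 7 * w k" using wv[of k] by (simp add: Q_def)
      then have "w (Suc k) powr s \<le> (2 / 3 ^ 7 * w k) powr s" using s w0 by (intro powr_mono2) auto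
      also have "\<dots> = (2 / 3 ^ 7) powr s * w k powr s" by (rule powr_mult)
      also have "\<dots> \<le> 1 / 8 * w k powr s" using ratio by (intro mult_right_mono) auto
      finally have "(2 * l k)\<^sup>2 * w (Suc k) powr s \<le> (2 * l k)\<^sup>2 * (1 / 8 * w k powr s)"
        by (intro mult_left_mono) auto
      then have "X (Suc k) \<le> X k / 2"
        unfolding X_def l(2) power_mult_distrib by (simp add: ac_simps)
      then show ?thesis using C' F0[of "Suc k"] by (simp add: add_increasing2)
    qed
    \<comment> \<open>The measure has total mass 1, so the lowest level contributes only a multiple
      of \<open>a\<^sup>2\<close>, which disappears in the limit.\<close>
    have X_0: "X 0 \<le> a\<^sup>2"
      using w1[of 0] w0[of 0] s by (simp add: X_def l_def mult_left_le powr_le1)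
    obtain M where M: "0 < M" "\<And>x. x \<in> sphere 0 1 \<Longrightarrow> \<bar>f x\<bar> \<le> M"
      using sphere_bounded[OF cf] by metis
    \<comment> \<open>As \<open>f\<close> is bounded, finitely many levels reach its maximum. The
      number \<open>n\<close> depends on \<open>f\<close> and \<open>a\<close>, but the final bound
      does not involve it.\<close>
    obtain n where n: "M / a < 2 ^ n" using real_arch_pow[of 2 "M / a"] by auto
    have fl: "\<bar>f x\<bar> < 2 ^ Suc n * a" if "x \<in> sphere 0 1" for x
    proof -
      have "M < 2 ^ n * a" using n a by (simp add: field_simps)
      then show ?thesis using M(2)[OF that] a by simp
    qed
    have "(\<Sum>k\<le>n. F k) = (\<integral>x. (\<Sum>k\<le>n. (g k x)\<^sup>2 + carre_du_champ (g k) x) \<partial>sphere_measure)"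
    proof -
      have "integrable sphere_measure (\<lambda>x. (g k x)\<^sup>2)" "integrable sphere_measure (carre_du_champ (g k))" for k
        using smooth_on_sphere_imp_continuous[OF g(1)] continuous_on_carre_du_champ[OF g(1)]
        by (auto intro!: integrable_sphere_measure continuous_intros)
      then show ?thesis unfolding F_def
        by (subst Bochner_Integration.integral_sum) auto
    qed
    also have "\<dots> \<le> (\<integral>x. 300 * ((f x)\<^sup>2 + carre_du_champ f x) \<partial>sphere_measure)"
    proof (rule integral_sphere_mono)
      fix x :: 'a assume x: "x \<in> sphere 0 1"
      show "(\<Sum>k\<le>n. (g k x)\<^sup>2 + carre_du_champ (g k) x) \<le> 300 * ((f x)\<^sup>2 + carre_du_champ f x)"
        using bump_energy_sum_le[OF f a x] by (simp only: g_def[abs_def] l_def)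
    qed (use smooth_on_sphere_imp_continuous[OF g(1)] continuous_on_carre_du_champ[OF g(1)]
          cf continuous_on_carre_du_champ[OF f] in \<open>auto intro!: continuous_intros\<close>)
    also have "\<dots> = 300 * ((\<integral>x. (f x)\<^sup>2 \<partial>sphere_measure) + (\<integral>x. carre_du_champ f x \<partial>sphere_measure))"
    proof -
      have "integrable sphere_measure (\<lambda>x. (f x)\<^sup>2)" "integrable sphere_measure (carre_du_champ f)"
        using cf continuous_on_carre_du_champ[OF f]
        by (auto intro!: integrable_sphere_measure continuous_intros)
      then show ?thesis by simp
    qed
    finally have sumF: "(\<Sum>k\<le>n. F k) \<le> 300 * ((\<integral>x. (f x)\<^sup>2 \<partial>sphere_measure) + (\<integral>x. carre_du_champ f x \<partial>sphere_measure))" .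
    have "(\<Sum>k\<le>n. X k) \<le> 2 * X 0 + 2 * (\<Sum>k\<le>n. C' * F k)"
      using step X0 F0 C' by (intro sum_le_of_half_recurrence) auto
    also have "\<dots> \<le> 2 * a\<^sup>2 + 2 * C' * (\<Sum>k\<le>n. F k)"
      using X_0 by (simp add: sum_distrib_left mult.assoc)
    also have "\<dots> \<le> 2 * a\<^sup>2 + 2 * C' * (300 * ((\<integral>x. (f x)\<^sup>2 \<partial>sphere_measure) + (\<integral>x. carre_du_champ f x \<partial>sphere_measure)))"
      using sumF C' by (intro add_left_mono mult_left_mono) auto
    finally have sumX: "(\<Sum>k\<le>n. X k) \<le> 2 * a\<^sup>2 + 2 * C' * (300 * ((\<integral>x. (f x)\<^sup>2 \<partial>sphere_measure) + (\<integral>x. carre_du_champ f x \<partial>sphere_measure)))" .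
    have "(\<integral>x. \<bar>f x\<bar> powr q \<partial>sphere_measure) \<le>
        (\<integral>x. a powr q + D * (\<Sum>k\<le>n. l k powr q * bump (l k) (f x)) \<partial>sphere_measure)"
    proof (rule integral_sphere_mono)
      fix x :: 'a assume x: "x \<in> sphere 0 1"
      show "\<bar>f x\<bar> powr q \<le> a powr q + D * (\<Sum>k\<le>n. l k powr q * bump (l k) (f x))"
        using powr_le_bump_sum[OF a q(1) fl[OF x]] by (simp only: D_def l_def)
    next
      show "continuous_on (sphere 0 1) (\<lambda>x. \<bar>f x\<bar> powr q)"
        using cf q by (intro continuous_on_powr' continuous_intros) auto
    qed (use cb in \<open>auto intro!: continuous_intros\<close>)
    also have "\<dots> = a powr q + D * (\<Sum>k\<le>n. l k powr q * w k)"
    proof -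
      interpret prob_space "sphere_measure :: 'a measure" by (rule prob_space_sphere_measure)
      show ?thesis unfolding w_def using ib prob_space by simp
    qed
    finally have "(\<integral>x. \<bar>f x\<bar> powr q \<partial>sphere_measure) powr s \<le>
        (a powr q + (\<Sum>k\<le>n. D * (l k powr q * w k))) powr s"
      using s by (intro powr_mono2 integral_sphere_nonneg) (auto simp: sum_distrib_left)
    also have "\<dots> \<le> (a powr q) powr s + (\<Sum>k\<le>n. D * (l k powr q * w k)) powr s"
      using s D w0 by (intro powr_add_le sum_nonneg mult_nonneg_nonneg) auto
    \<comment> \<open>As \<open>s \<le> 1\<close>, the power can be taken inside the sum;
      \<open>q * s = 2\<close> then turns each summand into a multiple of
      \<open>X k\<close>.\<close>
    also have "\<dots> \<le> (a powr q) powr s + (\<Sum>k\<le>n. (D * (l k powr q * w k)) powr s)"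
      using s D w0 by (intro add_left_mono powr_sum_le mult_nonneg_nonneg) auto
    also have "\<dots> = a\<^sup>2 + D powr s * (\<Sum>k\<le>n. X k)"
    proof -
      have "(D * (l k powr q * w k)) powr s = D powr s * X k" for k
        using D w0[of k] l(1)[of k] q by (simp add: X_def powr_mult powr_powr)
      then show ?thesis using a q by (simp add: powr_powr sum_distrib_left)
    qed
    also have "\<dots> \<le> a\<^sup>2 + D powr s * (2 * a\<^sup>2 + 2 * C' * (300 * ((\<integral>x. (f x)\<^sup>2 \<partial>sphere_measure) + (\<integral>x. carre_du_champ f x \<partial>sphere_measure))))"
      using sumX by (intro add_left_mono mult_left_mono) auto
    finally show ?thesis by (simp add: B_def algebra_simps)
  qed
  show ?thesis
  proof (rule that[OF B])
    fix f :: "'a \<Rightarrow> real" assume f: "smooth_on_sphere f"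
    let ?T = "B * ((\<integral>x. (f x)\<^sup>2 \<partial>sphere_measure) + (\<integral>x. carre_du_champ f x \<partial>sphere_measure))"
    let ?L = "(\<integral>x. \<bar>f x\<bar> powr q \<partial>sphere_measure) powr s"
    have "?L \<le> ?T + e" if "0 < e" for e
    proof -
      \<comment> \<open>The starting level is \<open>sqrt (e / K)\<close>, so that the error term is
        exactly \<open>e\<close>.\<close>
      define K where "K = 1 + 2 * D powr s"
      have K: "0 < K" by (simp add: K_def add_pos_nonneg)
      have "?L \<le> K * (sqrt (e / K))\<^sup>2 + ?T"
        unfolding K_def by (rule main[OF f]) (use that K in \<open>simp add: K_def\<close>)
      then show ?thesis using that K by simp
    qed
    then show "(\<integral>x. \<bar>f x\<bar> powr (2 * real d / (real d - 2)) \<partial>sphere_measure) powr ((real d - 2) / real d) \<le> ?T"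
      unfolding q_def[symmetric] s_def[symmetric] by (rule field_le_epsilon)
  qed
qed

section \<open>Poincare inequality\<close>

text \<open>For \<open>m = d + 2\<close> the hypothesis has \<open>p = 2\<close> and \<open>A = 1\<close>, so it is a Poincare inequality for
  nonnegative functions; adding a constant removes the sign condition.\<close>

lemma Poincare_inequality:
  fixes d :: nat and f :: "'a::euclidean_space \<Rightarrow> real"
  assumes d: "2 \<le> d"
    and beckner: "\<And>(m::real) (f :: 'a \<Rightarrow> real).
      m \<ge> real d + 2 \<Longrightarrow> smooth_on_sphere f \<Longrightarrow> (\<forall>x\<in>sphere 0 1. 0 \<le> f x) \<Longrightarrow>
      (\<integral>x. (f x)\<^sup>2 \<partial>sphere_measure) \<le>
        beckner_A m d * (\<integral>x. f x powr (2 / beckner_p m d) \<partial>sphere_measure) powr beckner_p m d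
        + 16 / ((m + 2 - real d) * (3 * real d - 2 + m)) * (\<integral>x. carre_du_champ f x \<partial>sphere_measure)"
    and f: "smooth_on_sphere f"
  shows "(\<integral>x. (f x - (\<integral>x. f x \<partial>sphere_measure))\<^sup>2 \<partial>sphere_measure) \<le>
    (\<integral>x. carre_du_champ f x \<partial>sphere_measure) / real d"
proof -
  interpret prob_space "sphere_measure :: 'a measure" by (rule prob_space_sphere_measure)
  have cf: "continuous_on (sphere 0 1) f" by (rule smooth_on_sphere_imp_continuous[OF f])
  obtain B where B: "0 < B" "\<And>x. x \<in> sphere 0 1 \<Longrightarrow> \<bar>f x\<bar> \<le> B"
    using sphere_bounded[OF cf] by metis
  define g where "g x = f x + B" for x
  define M where "M = (\<integral>x. f x \<partial>sphere_measure)"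
  have g: "smooth_on_sphere g" unfolding g_def[abs_def]
    by (intro smooth_on_sphere_add smooth_on_sphere_const f)
  have cg: "continuous_on (sphere 0 1) g" by (rule smooth_on_sphere_imp_continuous[OF g])
  have g0: "0 \<le> g x" if "x \<in> sphere 0 1" for x using B(2)[OF that] by (auto simp: g_def)
  have i: "integrable sphere_measure f" "integrable sphere_measure g" "integrable sphere_measure (\<lambda>x. (g x)\<^sup>2)"
    using cf cg by (auto intro!: integrable_sphere_measure continuous_intros)
  have Mg: "(\<integral>x. g x \<partial>sphere_measure) = M + B"
    unfolding g_def M_def using i(1) prob_space by simp
  have MB: "0 \<le> M + B" unfolding Mg[symmetric] using g0 by (rule integral_sphere_nonneg)
  have E: "(\<integral>x. carre_du_champ g x \<partial>sphere_measure) = (\<integral>x. carre_du_champ f x \<partial>sphere_measure)"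
  proof (rule Bochner_Integration.integral_cong)
    fix x :: 'a assume "x \<in> space sphere_measure"
    moreover have D: "((\<lambda>t. t + B) has_real_derivative 1) (at (f x))"
      by (auto intro!: derivative_eq_intros)
    ultimately show "carre_du_champ g x = carre_du_champ f x"
      unfolding g_def[abs_def] using carre_du_champ_chain[OF f _ D] by simp
  qed simp
  have p: "beckner_p (real d + 2) d = 2" by (simp add: beckner_p_def)
  \<comment> \<open>For \<open>m = d + 2\<close> the energy factor is
    \<open>16 / (4 * (4 * d)) = 1 / d\<close>, the reciprocal of the spectral gap of the
    sphere.\<close>
  have "(\<integral>x. (g x)\<^sup>2 \<partial>sphere_measure) \<le> (\<integral>x. g x powr 1 \<partial>sphere_measure) powr 2
      + 16 / (4 * (4 * real d)) * (\<integral>x. carre_du_champ f x \<partial>sphere_measure)"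
    using beckner[of "real d + 2" g] g g0 d by (simp add: p beckner_A_Poincare E)
  also have "(\<integral>x. g x powr 1 \<partial>sphere_measure) = M + B"
    unfolding Mg[symmetric] using g0 by (intro Bochner_Integration.integral_cong) auto
  finally have "(\<integral>x. (g x)\<^sup>2 \<partial>sphere_measure) \<le> (M + B)\<^sup>2
      + (\<integral>x. carre_du_champ f x \<partial>sphere_measure) / real d"
    using MB by (simp add: powr_numeral)
  moreover have "(\<integral>x. (f x - M)\<^sup>2 \<partial>sphere_measure) = (\<integral>x. (g x)\<^sup>2 \<partial>sphere_measure) - (M + B)\<^sup>2"
  proof -
    have "(\<integral>x. (f x - M)\<^sup>2 \<partial>sphere_measure) =
        (\<integral>x. (g x)\<^sup>2 - 2 * (M + B) * g x + (M + B)\<^sup>2 \<partial>sphere_measure)"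
      by (intro Bochner_Integration.integral_cong) (auto simp: g_def power2_eq_square algebra_simps)
    also have "\<dots> = (\<integral>x. (g x)\<^sup>2 \<partial>sphere_measure) - 2 * (M + B) * (M + B) + (M + B)\<^sup>2"
      using i prob_space by (simp add: Mg)
    finally show ?thesis by (simp add: power2_eq_square)
  qed
  ultimately show ?thesis by (simp add: M_def)
qed

subsection \<open>Tightening\<close>

text \<open>The homogeneous form of \<open>powr_one_plus_le\<close>, with
  \<open>u = h / M\<close>.\<close>

lemma powr_add_expansion_le:
  fixes M h q :: real
  assumes q: "2 \<le> q" and M: "M \<noteq> 0"
  shows "\<bar>M + h\<bar> powr q \<le> \<bar>M\<bar> powr q + q * \<bar>M\<bar> powr q / M * h +
    ((q + 1) powr q + q\<^sup>2) * (\<bar>M\<bar> powr q / M\<^sup>2 * h\<^sup>2 + \<bar>h\<bar> powr q)"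
proof -
  define K where "K = (q + 1) powr q + q\<^sup>2"
  have "\<bar>M + h\<bar> = \<bar>M\<bar> * \<bar>1 + h / M\<bar>" using M by (simp add: abs_mult[symmetric] distrib_left)
  then have "\<bar>M + h\<bar> powr q = \<bar>M\<bar> powr q * \<bar>1 + h / M\<bar> powr q" by (simp add: powr_mult)
  also have "\<dots> \<le> \<bar>M\<bar> powr q * (1 + q * (h / M) + K * ((h / M)\<^sup>2 + \<bar>h / M\<bar> powr q))"
    unfolding K_def by (intro mult_left_mono powr_one_plus_le q) auto
  also have "\<dots> = \<bar>M\<bar> powr q + q * \<bar>M\<bar> powr q / M * h + K * (\<bar>M\<bar> powr q / M\<^sup>2 * h\<^sup>2 + \<bar>h\<bar> powr q)"
  proof -
    have "\<bar>M\<bar> powr q * \<bar>h / M\<bar> powr q = \<bar>h\<bar> powr q" using M by (simp add: powr_divide)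
    then show ?thesis by (simp add: distrib_left power_divide mult.left_commute[of _ K])
  qed
  finally show ?thesis by (simp only: K_def)
qed

text \<open>The point is the coefficient 1 of \<open>M\<^sup>2\<close>: everything else on the right
  measures the deviation from the mean and can be controlled by the energy.\<close>

lemma Lp_tightening:
  fixes f :: "'a::euclidean_space \<Rightarrow> real"
  assumes q: "2 \<le> q" and cf: "continuous_on (sphere 0 1) f"
    and M: "M = (\<integral>x. f x \<partial>sphere_measure)"
    and K: "K = (q + 1) powr q + q\<^sup>2"
  shows "(\<integral>x. \<bar>f x\<bar> powr q \<partial>sphere_measure) powr (2 / q) \<le>
    M\<^sup>2 + K * (\<integral>x. (f x - M)\<^sup>2 \<partial>sphere_measure) +
    K powr (2 / q) * (\<integral>x. \<bar>f x - M\<bar> powr q \<partial>sphere_measure) powr (2 / q)"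
proof -
  interpret prob_space "sphere_measure :: 'a measure" by (rule prob_space_sphere_measure)
  define s where "s = 2 / q"
  have s: "0 < s" "s \<le> 1" "q * s = 2" using q by (auto simp: s_def)
  define V H where "V = (\<integral>x. (f x - M)\<^sup>2 \<partial>sphere_measure)"
    and "H = (\<integral>x. \<bar>f x - M\<bar> powr q \<partial>sphere_measure)"
  have V0: "0 \<le> V" and H0: "0 \<le> H" unfolding V_def H_def by simp_all
  have K1: "1 \<le> K" unfolding K using q one_le_power[of q 2] by (simp add: add_increasing)
  have i: "integrable sphere_measure f" "integrable sphere_measure (\<lambda>x. f x - M)"
    "integrable sphere_measure (\<lambda>x. (f x - M)\<^sup>2)" "integrable sphere_measure (\<lambda>x. \<bar>f x - M\<bar> powr q)"
    using cf q by (auto intro!: integrable_sphere_measure continuous_intros continuous_on_powr')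
  have int0: "(\<integral>x. f x - M \<partial>sphere_measure) = 0"
    using i(1) prob_space by (simp add: M)
  have "(\<integral>x. \<bar>f x\<bar> powr q \<partial>sphere_measure) powr s \<le> M\<^sup>2 + K * V + K powr s * H powr s"
  proof (cases "M = 0")
    \<comment> \<open>Now \<open>f - M\<close> is \<open>f\<close>, and \<open>K \<ge> 1\<close>
      makes the last term on the right large enough.\<close>
    case True
    have "1 * H powr s \<le> K powr s * H powr s"
      using K1 s by (intro mult_right_mono ge_one_powr_ge_zero) auto
    moreover have "0 \<le> K * V" using K1 V0 by simp
    ultimately show ?thesis using True by (simp add: H_def)
  next
    case False
    define m where "m = \<bar>M\<bar> powr q"
    have m: "0 < m" "m powr s = M\<^sup>2" using False s by (auto simp: m_def powr_powr)
    have "(\<integral>x. \<bar>f x\<bar> powr q \<partial>sphere_measure) \<le>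
        (\<integral>x. m + q * m / M * (f x - M) + K * (m / M\<^sup>2 * (f x - M)\<^sup>2 + \<bar>f x - M\<bar> powr q) \<partial>sphere_measure)"
    proof (rule integral_sphere_mono)
      fix x
      show "\<bar>f x\<bar> powr q \<le> m + q * m / M * (f x - M) + K * (m / M\<^sup>2 * (f x - M)\<^sup>2 + \<bar>f x - M\<bar> powr q)"
        using powr_add_expansion_le[OF q False, of "f x - M"] by (simp add: m_def K)
    qed (use cf q False in \<open>auto intro!: continuous_intros continuous_on_powr'\<close>)
    \<comment> \<open>The linear term is gone because \<open>M\<close> is the mean.\<close>
    also have "\<dots> = m + K * (m / M\<^sup>2 * V + H)"
      using i(2-4) prob_space by (simp add: V_def H_def int0)
    also have "\<dots> = m * (1 + K * V / M\<^sup>2) + K * H" by (simp add: algebra_simps)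
    finally have "(\<integral>x. \<bar>f x\<bar> powr q \<partial>sphere_measure) powr s \<le> (m * (1 + K * V / M\<^sup>2) + K * H) powr s"
      using s by (intro powr_mono2 integral_sphere_nonneg) auto
    also have "\<dots> \<le> (m * (1 + K * V / M\<^sup>2)) powr s + (K * H) powr s"
      using s m K1 V0 H0 by (intro powr_add_le mult_nonneg_nonneg add_nonneg_nonneg divide_nonneg_nonneg) auto
    also have "\<dots> = M\<^sup>2 * (1 + K * V / M\<^sup>2) powr s + K powr s * H powr s"
      using m K1 V0 H0 by (simp add: powr_mult)
    \<comment> \<open>Replacing the exponent \<open>s\<close> by 1 makes \<open>M\<^sup>2\<close>
      cancel against its reciprocal, leaving \<open>M\<^sup>2 + K * V\<close>.\<close>
    also have "(1 + K * V / M\<^sup>2) powr s \<le> (1 + K * V / M\<^sup>2) powr 1"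
      using s K1 V0 by (intro powr_mono) auto
    also have "M\<^sup>2 * (1 + K * V / M\<^sup>2) powr 1 = M\<^sup>2 + K * V"
      using False K1 V0 by (simp add: abs_of_nonneg field_simps)
    finally show ?thesis by (simp add: mult_left_mono)
  qed
  then show ?thesis by (simp only: s_def V_def H_def)
qed

theorem theorem21:
  fixes d :: nat
  assumes dim: "CARD('n::finite) = d + 1"
    and d: "2 \<le> d"
    and exponent_finite: "d \<noteq> 2"
    and beckner: "\<And>(m::real) (f :: real ^ 'n \<Rightarrow> real).
      m \<ge> real d + 2 \<Longrightarrow> smooth_on_sphere f \<Longrightarrow> (\<forall>x\<in>sphere 0 1. 0 \<le> f x) \<Longrightarrow>
      (\<integral>x. (f x)\<^sup>2 \<partial>sphere_measure) \<le>
        beckner_A m d * (\<integral>x. f x powr (2 / beckner_p m d) \<partial>sphere_measure) powr beckner_p m d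
        + 16 / ((m + 2 - real d) * (3 * real d - 2 + m)) * (\<integral>x. carre_du_champ f x \<partial>sphere_measure)"
  shows "\<exists>C>0. \<forall>f :: real ^ 'n \<Rightarrow> real. smooth_on_sphere f \<longrightarrow>
      (\<integral>x. \<bar>f x\<bar> powr (2 * real d / (real d - 2)) \<partial>sphere_measure) powr ((real d - 2) / real d)
        \<le> (\<integral>x. (f x)\<^sup>2 \<partial>sphere_measure) + C * (\<integral>x. carre_du_champ f x \<partial>sphere_measure)"
proof -
  interpret prob_space "sphere_measure :: (real ^ 'n) measure" by (rule prob_space_sphere_measure)
  have d3: "3 \<le> d" using d exponent_finite by simp
  define q where "q = 2 * real d / (real d - 2)"
  have q: "2 \<le> q" and qs: "2 / q = (real d - 2) / real d" using d3 by (auto simp: q_def field_simps)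
  obtain C where C: "0 < C" and nash: "\<And>g :: real ^ 'n \<Rightarrow> real. smooth_on_sphere g \<Longrightarrow> (\<forall>x\<in>sphere 0 1. 0 \<le> g x) \<Longrightarrow>
    (\<integral>x. (g x)\<^sup>2 \<partial>sphere_measure) \<le>
      C * ((\<integral>x. g x \<partial>sphere_measure)\<^sup>2 / (\<integral>x. (g x)\<^sup>2 \<partial>sphere_measure)) powr (2 / real d) *
      ((\<integral>x. (g x)\<^sup>2 \<partial>sphere_measure) + (\<integral>x. carre_du_champ g x \<partial>sphere_measure))"
    by (rule Nash_inequality[OF d beckner]) (assumption+, rule that, assumption, blast)
  obtain B where B: "0 < B" and sob: "\<And>f :: real ^ 'n \<Rightarrow> real. smooth_on_sphere f \<Longrightarrow>
    (\<integral>x. \<bar>f x\<bar> powr q \<partial>sphere_measure) powr (2 / q) \<le>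
      B * ((\<integral>x. (f x)\<^sup>2 \<partial>sphere_measure) + (\<integral>x. carre_du_champ f x \<partial>sphere_measure))"
    by (rule Sobolev_inequality_nontight[OF d3 C nash, folded q_def qs])
      (assumption+, rule that, assumption, blast)
  define K where "K = (q + 1) powr q + q\<^sup>2"
  have K: "0 < K" using q by (simp add: K_def add_pos_pos)
  \<comment> \<open>\<open>K\<close> comes from \<open>V \<le> E\<close>, the factor 2 from
    \<open>V + E \<le> 2 * E\<close>.\<close>
  define C0 where "C0 = K + K powr (2 / q) * (B * 2)"
  have "0 < C0" using K B by (simp add: C0_def add_pos_pos)
  moreover have "(\<integral>x. \<bar>f x\<bar> powr q \<partial>sphere_measure) powr (2 / q)
        \<le> (\<integral>x. (f x)\<^sup>2 \<partial>sphere_measure) + C0 * (\<integral>x. carre_du_champ f x \<partial>sphere_measure)"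
    if f: "smooth_on_sphere f" for f :: "real ^ 'n \<Rightarrow> real"
  proof -
    have cf: "continuous_on (sphere 0 1) f" by (rule smooth_on_sphere_imp_continuous[OF f])
    define M V E where "M = (\<integral>x. f x \<partial>sphere_measure)" and "V = (\<integral>x. (f x - M)\<^sup>2 \<partial>sphere_measure)"
      and "E = (\<integral>x. carre_du_champ f x \<partial>sphere_measure)"
    have E0: "0 \<le> E" unfolding E_def by (intro integral_sphere_nonneg carre_du_champ_nonneg)
    have "V \<le> E / real d"
      unfolding V_def M_def E_def by (rule Poincare_inequality[OF d beckner f])
    also have "\<dots> \<le> E" using E0 d by (simp add: divide_le_eq mult_left_le_one_le mult_le_cancel_left1)
    finally have VE: "V \<le> E" .
    have i: "integrable sphere_measure f" "integrable sphere_measure (\<lambda>x. (f x - M)\<^sup>2)"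
      using cf by (auto intro!: integrable_sphere_measure continuous_intros)
    have "(\<integral>x. (f x)\<^sup>2 \<partial>sphere_measure) = (\<integral>x. (f x - M)\<^sup>2 + 2 * M * f x - M\<^sup>2 \<partial>sphere_measure)"
      by (intro Bochner_Integration.integral_cong) (auto simp: power2_eq_square algebra_simps)
    also have "\<dots> = V + 2 * M * M - M\<^sup>2"
      using i prob_space by (simp add: V_def M_def[symmetric])
    finally have L2: "(\<integral>x. (f x)\<^sup>2 \<partial>sphere_measure) = V + M\<^sup>2" by (simp add: power2_eq_square)
    have V0: "0 \<le> V" by (simp add: V_def)
    have "smooth_on_sphere (\<lambda>x. f x + (- M))" by (intro smooth_on_sphere_add smooth_on_sphere_const f)
    then have h: "smooth_on_sphere (\<lambda>x. f x - M)" by simp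
    have Eh: "(\<integral>x. carre_du_champ (\<lambda>x. f x - M) x \<partial>sphere_measure) = E"
      unfolding E_def
    proof (rule Bochner_Integration.integral_cong)
      fix x :: "real ^ 'n" assume "x \<in> space sphere_measure"
      moreover have D: "((\<lambda>t. t - M) has_real_derivative 1) (at (f x))"
        by (auto intro!: derivative_eq_intros)
      ultimately show "carre_du_champ (\<lambda>x. f x - M) x = carre_du_champ f x"
        using carre_du_champ_chain[OF f _ D] by simp
    qed simp
    have "(\<integral>x. \<bar>f x\<bar> powr q \<partial>sphere_measure) powr (2 / q) \<le>
        M\<^sup>2 + K * V + K powr (2 / q) * (\<integral>x. \<bar>f x - M\<bar> powr q \<partial>sphere_measure) powr (2 / q)"
      unfolding V_def by (rule Lp_tightening[OF q cf M_def K_def])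
    \<comment> \<open>The Sobolev inequality is applied to \<open>f - M\<close>: its squared L2 norm
      is \<open>V\<close>, which the Poincare inequality bounds by \<open>E\<close>, so only the
      energy remains beside \<open>M\<^sup>2\<close>.\<close>
    also have "\<dots> \<le> M\<^sup>2 + K * E + K powr (2 / q) * (B * (V + E))"
      using sob[OF h] VE K by (intro add_mono mult_left_mono) (auto simp: Eh V_def)
    also have "\<dots> \<le> M\<^sup>2 + K * E + K powr (2 / q) * (B * (2 * E))"
      using VE B by (intro add_left_mono mult_left_mono) auto
    also have "\<dots> \<le> V + M\<^sup>2 + C0 * E" using V0 by (simp add: C0_def algebra_simps)
    finally show ?thesis by (simp only: L2 E_def)
  qed
  ultimately have "\<exists>C>0. \<forall>f :: real ^ 'n \<Rightarrow> real. smooth_on_sphere f \<longrightarrow>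
      (\<integral>x. \<bar>f x\<bar> powr q \<partial>sphere_measure) powr (2 / q)
        \<le> (\<integral>x. (f x)\<^sup>2 \<partial>sphere_measure) + C * (\<integral>x. carre_du_champ f x \<partial>sphere_measure)"
    by (intro exI[of _ C0] conjI allI impI)
  then show ?thesis unfolding qs unfolding q_def .
qed

end
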